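(* Every good triple $(x_1,x_2,x_3)$ with $x_1^2+x_2^2+x_3^2-x_1x_2x_3\neq4$ belongs (up to equivalence of triples) to the $B_3$-orbit of one of the following five triples: (1) $(-2\cos\frac\pi2,-2\cos\frac\pi3,-2\cos\frac\pi3)$; (2) $(-2\cos\frac\pi2,-2\cos\frac\pi3,-2\cos\frac\pi4)$; (3) $(-2\cos\frac\pi2,-2\cos\frac\pi3,-2\cos\frac\pi5)$; (4) $(-2\cos\frac\pi2,-2\cos\frac\pi3,-2\cos\frac{2\pi}5)$; (5) $(-2\cos\frac\pi2,-2\cos\frac\pi5,-2\cos\frac{2\pi}5)$. All these orbits are finite and pairwise distinct. They contain all the permutations of the triples (1), (2), (3), (4), (5) and also, respectively, the following triples together with all their permutations: (1') $(2\cos\frac\pi3,2\cos\frac\pi3,2\cos\frac\pi3)$; (2') $(-2\cos\frac{2\pi}3,-2\cos\frac\pi4,-2\cos\frac\pi4)$; (3') $(-2\cos\frac{2\pi}3,-2\cos\frac\pi5,-2\cos\frac\pi5)$ and $(-2\cos\frac{4\pi}5,-2\cos\frac{4\pi}5,-2\cos\frac{4\pi}5)$; (4') $(-2\cos\frac{2\pi}3,-2\cos\frac{2\pi}5,-2\cos\frac{2\pi}5)$ and $(-2\cos\frac{2\pi}5,-2\cos\frac{2\pi}5,-2\cos\frac{2\pi}5)$; (5') $(-2\cos\frac{3\pi}5,-2\cos\frac\pi3,-2\cos\frac\pi5)$, $(-2\cos\frac{2\pi}5,-2\cos\frac\pi3,-2\cos\frac\pi3)$ and $(-2\cos\frac{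2\pi}3,-2\cos\frac\pi3,-2\cos\frac\pi5)$.
   Context: The braid group $B_3=\langle\beta_1,\beta_2\mid\beta_1\beta_2\beta_1=\beta_2\beta_1\beta_2\rangle$ acts on triples by $$\beta_1:(x_1,x_2,x_3)\mapsto(-x_1,\,x_3-x_1x_2,\,x_2),\qquad \beta_2:(x_1,x_2,x_3)\mapsto(x_3,\,-x_2,\,x_1-x_2x_3),$$ considered on triples modulo equivalence, where two triples are equivalent if they differ by changing the signs of two of the coordinates. The quantity $x_1^2+x_2^2+x_3^2-x_1x_2x_3$ is invariant. A triple is admissible if at most one coordinate is zero. An admissible triple is good if for every $\beta\in B_3$ one has $\beta(x_1,x_2,x_3)=(-2\cos\pi r_1^\beta,-2\cos\pi r_2^\beta,-2\cos\pi r_3^\beta)$ with rational numbers $0\le r_i^\beta\le1$. *)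

theory Defs
  imports Complex_Main "HOL-Algebra.Group_Action"
begin

datatype braid_gen = Beta1 | Beta2

text \<open>A letter is a generator with a flag; \<open>True\<close> marks the formal inverse.\<close>

type_synonym braid_word = "(braid_gen \<times> bool) list"

inductive braid_eq :: "braid_word \<Rightarrow> braid_word \<Rightarrow> bool" where
  refl: "braid_eq u u"
| sym: "braid_eq u v \<Longrightarrow> braid_eq v u"
| trans: "braid_eq u v \<Longrightarrow> braid_eq v w \<Longrightarrow> braid_eq u w"
| cong: "braid_eq u u' \<Longrightarrow> braid_eq v v' \<Longrightarrow> braid_eq (u @ v) (u' @ v')"
| cancel: "braid_eq [(g, e), (g, \<not> e)] []"
| braid: "braid_eq [(Beta1, False), (Beta2, False), (Beta1, False)]
                   [(Beta2, False), (Beta1, False), (Beta2, False)]"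

quotient_type braid = braid_word / braid_eq
  by (intro equivpI reflpI sympI transpI) (fact braid_eq.refl, erule braid_eq.sym, erule braid_eq.trans)

lift_definition braid_mult :: "braid \<Rightarrow> braid \<Rightarrow> braid" is "(@)"
  by (rule braid_eq.cong)

lift_definition braid_one :: braid is "[]" .

definition B3 :: "braid monoid" where
  "B3 = \<lparr>carrier = UNIV, mult = braid_mult, one = braid_one\<rparr>"

lemma braid_word_left_inverse: "\<exists>v. braid_eq (v @ u) []"
proof (induction u)
  case Nil
  show ?case by (rule exI[of _ "[]"]) (simp add: braid_eq.refl)
next
  case (Cons l u)
  obtain g e where l: "l = (g, e)" by (cases l)
  from Cons obtain v where v: "braid_eq (v @ u) []" by blast
  have "braid_eq ([(g, \<not> e), (g, e)] @ u) ([] @ u)"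
    by (rule braid_eq.cong) (use braid_eq.cancel[of g "\<not> e"] in \<open>simp_all add: braid_eq.refl\<close>)
  then have "braid_eq (v @ ([(g, \<not> e), (g, e)] @ u)) (v @ ([] @ u))"
    by (rule braid_eq.cong[OF braid_eq.refl])
  with v have "braid_eq ((v @ [(g, \<not> e)]) @ (l # u)) []"
    by (auto simp: l intro: braid_eq.trans)
  then show ?case by blast
qed

lemma group_B3: "group B3"
proof (rule groupI)
  fix x assume "x \<in> carrier B3"
  have "\<exists>y. braid_mult y x = braid_one"
    by transfer (rule braid_word_left_inverse)
  then show "\<exists>y\<in>carrier B3. y \<otimes>\<^bsub>B3\<^esub> x = \<one>\<^bsub>B3\<^esub>" by (simp add: B3_def)
next
  fix x y z :: braid
  have "braid_mult (braid_mult x y) z = braid_mult x (braid_mult y z)"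
    by transfer (simp add: braid_eq.refl)
  then show "x \<otimes>\<^bsub>B3\<^esub> y \<otimes>\<^bsub>B3\<^esub> z = x \<otimes>\<^bsub>B3\<^esub> (y \<otimes>\<^bsub>B3\<^esub> z)" by (simp add: B3_def)
next
  fix x :: braid
  have "braid_mult braid_one x = x" by transfer (simp add: braid_eq.refl)
  then show "\<one>\<^bsub>B3\<^esub> \<otimes>\<^bsub>B3\<^esub> x = x" by (simp add: B3_def)
qed (simp_all add: B3_def)

type_synonym triple = "complex \<times> complex \<times> complex"

fun gen_act :: "braid_gen \<Rightarrow> triple \<Rightarrow> triple" where
  "gen_act Beta1 (x1, x2, x3) = (- x1, x3 - x1 * x2, x2)"
| "gen_act Beta2 (x1, x2, x3) = (x3, - x2, x1 - x2 * x3)"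

definition letter_act :: "braid_gen \<times> bool \<Rightarrow> triple \<Rightarrow> triple" where
  "letter_act l = (if snd l then inv_into UNIV (gen_act (fst l)) else gen_act (fst l))"

text \<open>The rightmost letter acts first, so that this becomes a left action.\<close>

definition word_act :: "braid_word \<Rightarrow> triple \<Rightarrow> triple" where
  "word_act w = foldr letter_act w"

lemma bij_gen_act: "bij (gen_act g)"
proof (cases g)
  case Beta1
  show ?thesis unfolding Beta1
    by (rule o_bij[where g = "\<lambda>(y1, y2, y3). (- y1, y3, y2 - y1 * y3)"]) (auto simp: fun_eq_iff)
next
  case Beta2
  show ?thesis unfolding Beta2
    by (rule o_bij[where g = "\<lambda>(y1, y2, y3). (y3 - y1 * y2, - y2, y1)"]) (auto simp: fun_eq_iff)
qed

lemma inv_gen_act_Beta1: "inv_into UNIV (gen_act Beta1) (y1, y2, y3) = (- y1, y3, y2 - y1 * y3)"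
  by (rule inv_f_eq) (simp_all add: bij_is_inj[OF bij_gen_act])

lemma inv_gen_act_Beta2: "inv_into UNIV (gen_act Beta2) (y1, y2, y3) = (y3 - y1 * y2, - y2, y1)"
  by (rule inv_f_eq) (simp_all add: bij_is_inj[OF bij_gen_act])

lemma word_act_append: "word_act (u @ v) x = word_act u (word_act v x)"
  by (simp add: word_act_def)

lemma word_act_cong: "braid_eq u v \<Longrightarrow> word_act u = word_act v"
proof (induction rule: braid_eq.induct)
  case (cancel g e)
  show ?case
    by (cases g; cases e)
      (simp_all add: word_act_def letter_act_def fun_eq_iff inv_gen_act_Beta1 inv_gen_act_Beta2)
next
  case braid
  show ?case by (simp add: word_act_def letter_act_def fun_eq_iff algebra_simps)
qed (simp_all add: fun_eq_iff word_act_append del: split_paired_All)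

lift_definition braid_act :: "braid \<Rightarrow> triple \<Rightarrow> triple" is word_act
  by (rule word_act_cong)

fun sign_eq :: "triple \<Rightarrow> triple \<Rightarrow> bool" where
  "sign_eq (x1, x2, x3) (y1, y2, y3) \<longleftrightarrow>
     (y1, y2, y3) \<in> {(x1, x2, x3), (x1, - x2, - x3), (- x1, x2, - x3), (- x1, - x2, x3)}"

quotient_type triple_class = triple / sign_eq
  by (intro equivpI reflpI sympI transpI) auto

lemma sign_eq_gen_act: "sign_eq x y \<Longrightarrow> sign_eq (gen_act g x) (gen_act g y)"
  by (cases g; cases x; cases y) auto

lemma sign_eq_inv_gen_act:
  "sign_eq x y \<Longrightarrow> sign_eq (inv_into UNIV (gen_act g) x) (inv_into UNIV (gen_act g) y)"
  by (cases g; cases x; cases y) (auto simp: inv_gen_act_Beta1 inv_gen_act_Beta2)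

lemma sign_eq_word_act: "sign_eq x y \<Longrightarrow> sign_eq (word_act w x) (word_act w y)"
  by (induction w) (simp_all add: word_act_def letter_act_def sign_eq_gen_act sign_eq_inv_gen_act)

lift_definition cls :: "triple \<Rightarrow> triple_class" is "\<lambda>x. x" .

lift_definition class_act :: "braid \<Rightarrow> triple_class \<Rightarrow> triple_class" is braid_act
proof -
  fix b x y assume "sign_eq x y"
  then show "sign_eq (braid_act b x) (braid_act b y)"
    by (transfer fixing: x y) (rule sign_eq_word_act)
qed

lemma class_act_cls: "class_act b (cls x) = cls (braid_act b x)"
  by (simp add: cls.abs_eq class_act.abs_eq)

lemma cls_cases: obtains x where "X = cls x"
proof -
  have "\<exists>x. X = cls x"
    by (induction X rule: triple_class.abs_induct) (auto simp flip: cls.abs_eq)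
  then show thesis using that by blast
qed

lemma braid_act_one: "braid_act braid_one x = x"
  by (transfer fixing: x) (simp add: word_act_def)

lemma braid_act_mult: "braid_act (braid_mult b c) x = braid_act b (braid_act c x)"
  by (transfer fixing: x) (rule word_act_append)

lemma class_act_one: "class_act braid_one X = X"
  by (cases X rule: cls_cases) (simp add: class_act_cls braid_act_one)

lemma class_act_mult: "class_act (braid_mult b c) X = class_act b (class_act c X)"
  by (cases X rule: cls_cases) (simp add: class_act_cls braid_act_mult)

lemma group_action_B3: "group_action B3 UNIV class_act"
proof -
  interpret B3: group B3 by (rule group_B3)
  have bij: "bij (class_act b)" for b
  proof -
    define c where "c = m_inv B3 b"
    have c: "braid_mult c b = braid_one" "braid_mult b c = braid_one"
      using B3.l_inv[of b] B3.r_inv[of b] by (simp_all add: B3_def c_def)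
    show ?thesis
      by (rule o_bij[where g = "class_act c"])
        (simp_all add: fun_eq_iff c class_act_one flip: class_act_mult)
  qed
  show ?thesis
    unfolding group_action_def group_hom_def group_hom_axioms_def
  proof (intro conjI group_B3 group_BijGroup homI)
    show "class_act b \<in> carrier (BijGroup UNIV)" for b
      by (simp add: BijGroup_def Bij_def bij)
    show "class_act (b \<otimes>\<^bsub>B3\<^esub> c) = class_act b \<otimes>\<^bsub>BijGroup UNIV\<^esub> class_act c" for b c
      by (simp add: BijGroup_def Bij_def bij B3_def compose_def class_act_mult fun_eq_iff)
  qed
qed

fun admissible :: "triple \<Rightarrow> bool" where
  "admissible (x1, x2, x3) \<longleftrightarrow> length (filter (\<lambda>x. x = 0) [x1, x2, x3]) \<le> 1"

definition trig_triple :: "real \<Rightarrow> real \<Rightarrow> real \<Rightarrow> triple" where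
  "trig_triple r1 r2 r3 =
     (of_real (- 2 * cos (pi * r1)), of_real (- 2 * cos (pi * r2)), of_real (- 2 * cos (pi * r3)))"

definition good :: "triple \<Rightarrow> bool" where
  "good x \<longleftrightarrow> admissible x \<and>
     (\<forall>b\<in>carrier B3. \<exists>r1\<in>\<rat> \<inter> {0..1}. \<exists>r2\<in>\<rat> \<inter> {0..1}. \<exists>r3\<in>\<rat> \<inter> {0..1}.
        class_act b (cls x) = cls (trig_triple r1 r2 r3))"

definition braid_orbit :: "triple \<Rightarrow> triple_class set" where
  "braid_orbit x = orbit B3 class_act (cls x)"

fun permuted :: "triple \<Rightarrow> triple set" where
  "permuted (x1, x2, x3) =
     {(x1, x2, x3), (x1, x3, x2), (x2, x1, x3), (x2, x3, x1), (x3, x1, x2), (x3, x2, x1)}"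

definition base_triples :: "triple list" where
  "base_triples =
     [trig_triple (1/2) (1/3) (1/3),
      trig_triple (1/2) (1/3) (1/4),
      trig_triple (1/2) (1/3) (1/5),
      trig_triple (1/2) (1/3) (2/5),
      trig_triple (1/2) (1/5) (2/5)]"

text \<open>The sign in the first entry is positive, unlike in all the other triples.\<close>

definition further_triples :: "triple set list" where
  "further_triples =
     [{(of_real (2 * cos (pi / 3)), of_real (2 * cos (pi / 3)), of_real (2 * cos (pi / 3)))},
      {trig_triple (2/3) (1/4) (1/4)},
      {trig_triple (2/3) (1/5) (1/5), trig_triple (4/5) (4/5) (4/5)},
      {trig_triple (2/3) (2/5) (2/5), trig_triple (2/5) (2/5) (2/5)},
      {trig_triple (3/5) (1/3) (1/5), trig_triple (2/5) (1/3) (1/3), trig_triple (2/3) (1/3) (1/5)}]"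

end

theory Submission
  imports Defs "HOL-Computational_Algebra.Computational_Algebra"
begin

text \<open>
  Up to signs, the generators of the braid group act on \<open>(x, y, z)\<close> by Vieta moves and
  permutations that preserve \<open>c = x\<^sup>2 + y\<^sup>2 + z\<^sup>2 - x * y * z\<close>. All orbit
  entries of a good triple are sums \<open>z + inverse z\<close> for roots of unity \<open>z\<close>, and
  Galois conjugates of good triples are good again. A bounded real orbit has \<open>c \<le> 4\<close>, so
  \<open>c < 4\<close> at every conjugate.

  Let \<open>x = z + inverse z\<close> be a coordinate, with \<open>z\<^sup>2\<close> of order \<open>m\<close>. Then
  \<open>T = (4 - c) / (4 - x\<^sup>2)\<close> lies in \<open>(0, 1]\<close> at every conjugate. The norm of
  \<open>4 - c\<close> is at least 1, and that of \<open>4 - x\<^sup>2 = \<bar>1 - z\<^sup>2\<bar>\<^sup>2\<close> is small,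
  because for a prime \<open>p\<close> dividing \<open>m\<close> the product of the \<open>1 - (z\<^sup>2) ^ k\<close> over
  \<open>k < m\<close> not divisible by \<open>p\<close> is \<open>p\<close>. Hence \<open>T\<close> cannot be small on
  average. The move fixing \<open>x\<close> is a rotation of the conic through \<open>(y, z)\<close>, and
  \<open>1 - T\<close> is its squared radius up to a factor 4; as the orbit entries on the conic are
  algebraic integers, \<open>1 - T\<close> cannot be small either. Comparing both with
  \<open>T * (1 - T) \<le> 1 / 4\<close> gives \<open>m \<le> 5\<close>, and for \<open>m \<ge> 4\<close> one of the entries on
  the conic vanishes. So every orbit contains a triple \<open>(0, u, v)\<close>, and only five pairs
  \<open>(\<bar>u\<bar>, \<bar>v\<bar>)\<close> survive.
\<close>

section \<open>Galois conjugates of a root of unity\<close>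

text \<open>A polynomial \<open>f\<close> stands for the element \<open>ev f w\<close> of the ring
  generated by \<open>w\<close>; evaluating the same \<open>f\<close> at a conjugate
  \<open>z\<close> replaces the use of a field automorphism.\<close>

definition ev :: "int poly \<Rightarrow> complex \<Rightarrow> complex" where
  "ev f z = poly (map_poly of_int f) z"

lemma ev_0 [simp]: "ev 0 z = 0"
  and ev_1 [simp]: "ev 1 z = 1"
  and ev_pCons [simp]: "ev (pCons a f) z = of_int a + z * ev f z"
  by (simp_all add: ev_def map_poly_pCons)

lemma ev_add [simp]: "ev (f + g) z = ev f z + ev g z"
proof (induction f arbitrary: g)
  case (pCons a f)
  then show ?case by (cases g) (simp add: algebra_simps)
qed simp

lemma ev_smult [simp]: "ev (smult a f) z = of_int a * ev f z"
  by (induction f) (simp_all add: algebra_simps)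

lemma ev_uminus [simp]: "ev (- f) z = - ev f z"
  by (induction f) (simp_all add: algebra_simps)

lemma ev_diff [simp]: "ev (f - g) z = ev f z - ev g z"
  using ev_add[of f "- g" z] by simp

lemma ev_mult [simp]: "ev (f * g) z = ev f z * ev g z"
  by (induction f) (simp_all add: algebra_simps)

lemma ev_power [simp]: "ev (f ^ n) z = ev f z ^ n"
  by (induction n) simp_all

lemma ev_numeral [simp]: "ev (numeral n) z = numeral n"
  by (simp add: numeral_poly)

lemma ev_prod: "ev (\<Prod>i\<in>A. f i) z = (\<Prod>i\<in>A. ev (f i) z)"
  by (induction A rule: infinite_finite_induct) simp_all

lemma ev_monom [simp]: "ev (monom a n) z = of_int a * z ^ n"
  by (simp add: ev_def map_poly_monom poly_monom)

lemma ev_pcompose: "ev (pcompose f g) z = ev f (ev g z)"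
  by (induction f) (simp_all add: pcompose_pCons)

section \<open>Primitive roots of unity and minimal integer polynomials\<close>

lemma powers_of_primitive_root:
  fixes w :: complex
  assumes N: "N > 0" "w ^ N = 1" and min: "\<And>d. 0 < d \<Longrightarrow> d < N \<Longrightarrow> w ^ d \<noteq> 1"
  shows "inj_on (\<lambda>s. w ^ s) {..<N}" and "{z. z ^ N = 1} = (\<lambda>s. w ^ s) ` {..<N}"
proof -
  have w0: "w \<noteq> 0" using N by (auto simp: power_0_left)
  have neq: "w ^ s \<noteq> w ^ t" if "s < t" "t < N" for s t
  proof
    assume "w ^ s = w ^ t"
    also have "\<dots> = w ^ s * w ^ (t - s)" using that by (simp flip: power_add)
    finally have "w ^ (t - s) = 1" using w0 by simp
    moreover have "0 < t - s" "t - s < N" using that by auto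
    ultimately show False using min by blast
  qed
  show inj: "inj_on (\<lambda>s. w ^ s) {..<N}"
    by (rule inj_onI) (metis neq lessThan_iff nat_neq_iff)
  have "(w ^ s) ^ N = 1" for s
    using N by (metis mult.commute power_mult power_one)
  then have sub: "(\<lambda>s. w ^ s) ` {..<N} \<subseteq> {z. z ^ N = 1}" by auto
  have "card ((\<lambda>s. w ^ s) ` {..<N}) = card {z::complex. z ^ N = 1}"
    using card_image[OF inj] card_roots_unity_eq[of N] N by simp
  with sub show "{z. z ^ N = 1} = (\<lambda>s. w ^ s) ` {..<N}"
    using card_subset_eq[OF _ sub] finite_roots_unity[of N, where ?'a = complex] N
    by (metis One_nat_def Suc_leI)
qed

text \<open>Take \<open>P\<close> of least degree: pseudo-division by \<open>P\<close> stays within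
  integer polynomials, and its remainder vanishes at \<open>w\<close> and has smaller degree, hence
  is zero. The constant \<open>c\<close> stems from the leading coefficient of
  \<open>P\<close>.\<close>

lemma minimal_int_poly:
  assumes "F \<noteq> 0" "ev F w = 0"
  obtains P where "P \<noteq> 0" "ev P w = 0" "degree P \<le> degree F"
    "\<And>G. ev G w = 0 \<Longrightarrow> G \<noteq> 0 \<Longrightarrow> degree P \<le> degree G"
    "\<And>G. ev G w = 0 \<Longrightarrow> \<exists>c Q. c \<noteq> 0 \<and> smult c G = P * Q"
proof -
  obtain P where P: "P \<noteq> 0" "ev P w = 0"
    and min: "\<And>G. ev G w = 0 \<Longrightarrow> G \<noteq> 0 \<Longrightarrow> degree P \<le> degree G"
    using ex_has_least_nat[of "\<lambda>P. P \<noteq> 0 \<and> ev P w = 0" F degree] assms by blast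
  have "\<exists>c Q. c \<noteq> 0 \<and> smult c G = P * Q" if G: "ev G w = 0" for G
  proof -
    obtain c Q where c: "c \<noteq> 0" "smult c G = P * Q + pseudo_mod G P"
      using pseudo_mod(1)[OF \<open>P \<noteq> 0\<close>, of G] by auto
    have "ev (smult c G) w = 0" using G by simp
    then have "ev (pseudo_mod G P) w = 0" unfolding c(2) using P by simp
    with min pseudo_mod(2)[OF \<open>P \<noteq> 0\<close>, of G] have "pseudo_mod G P = 0"
      by (metis not_less)
    with c show ?thesis by auto
  qed
  then show thesis using that P min assms by blast
qed

text \<open>Gauss's lemma: the primitive part of a minimal polynomial divides the monic
  \<open>monom 1 N - 1\<close> over the integers, so its leading coefficient is a unit and can be
  normalised to 1.\<close>

lemma monic_minimal_int_poly:
  assumes N: "N > 0" "w ^ N = 1"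
  obtains P where "lead_coeff P = 1" "ev P w = 0" "P dvd monom 1 N - 1"
    "\<And>G. ev G w = 0 \<Longrightarrow> \<exists>c Q. c \<noteq> 0 \<and> smult c G = P * Q"
    "\<And>G. ev G w = 0 \<Longrightarrow> G \<noteq> 0 \<Longrightarrow> degree P \<le> degree G"
proof -
  define X :: "int poly" where "X = monom 1 N - 1"
  have "coeff X N = 1" using N by (simp add: X_def)
  have X: "degree X = N" "lead_coeff X = 1"
  proof -
    show "degree X = N"
      using N by (auto simp: X_def intro!: degree_diff_le_max order_antisym le_degree)
        (metis (no_types, lifting) degree_1 degree_diff_le degree_monom_le le0 le_trans)
    then show "lead_coeff X = 1" using \<open>coeff X N = 1\<close> by simp
  qed
  have X0: "X \<noteq> 0" "ev X w = 0" using X N by (auto simp: X_def)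
  obtain P where P: "P \<noteq> 0" "ev P w = 0"
    and min: "\<And>G. ev G w = 0 \<Longrightarrow> G \<noteq> 0 \<Longrightarrow> degree P \<le> degree G"
    and dv: "\<And>G. ev G w = 0 \<Longrightarrow> \<exists>c Q. c \<noteq> 0 \<and> smult c G = P * Q"
    using minimal_int_poly[OF X0] by metis
  define P' where "P' = primitive_part P"
  have PP': "P = smult (content P) P'" by (simp add: P'_def content_times_primitive_part)
  have cP: "content P \<noteq> 0" using P by simp
  have "of_int (content P) * ev P' w = 0" using P(2) PP' by (metis ev_smult)
  then have P': "P' \<noteq> 0" "ev P' w = 0" using P cP by (auto simp: P'_def)
  obtain c Q where c: "c \<noteq> 0" "smult c X = P * Q" using dv[OF X0(2)] by blast
  have "content X dvd 1" using content_dvd_coeff[of X "degree X"] X(2) by simp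
  then have "content X = 1" by (simp only: is_unit_content_iff)
  then have X_prim: "primitive_part X = X" by (rule primitive_part_prim)
  have "smult (unit_factor c) X = P' * primitive_part Q"
    using arg_cong[OF c(2), of primitive_part]
    by (simp add: primitive_part_smult primitive_part_mult X_prim P'_def)
  then have "P' dvd smult (unit_factor c) X" by simp
  then have dvdX: "P' dvd X"
    using c(1) by (cases "c > 0") (auto simp: sgn_if)
  then obtain R where R: "X = P' * R" by blast
  then have "lead_coeff P' * lead_coeff R = 1"
    using X(2) by (simp add: lead_coeff_mult)
  then have lc: "lead_coeff P' = 1 \<or> lead_coeff P' = -1"
    by (simp add: zmult_eq_1_iff) blast
  define P'' where "P'' = smult (lead_coeff P') P'"
  have "lead_coeff P'' = 1" using lc by (auto simp: P''_def)
  moreover have "ev P'' w = 0" using P' by (simp add: P''_def)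
  moreover have "P'' dvd monom 1 N - 1"
    using dvdX lc by (auto simp: P''_def X_def)
  moreover have "\<exists>c Q. c \<noteq> 0 \<and> smult c G = P'' * Q" if "ev G w = 0" for G
  proof -
    from dv[OF that] obtain c Q where c: "c \<noteq> 0" "smult c G = P * Q" by blast
    have "P = P'' * [:content P * lead_coeff P':]"
      using lc by (subst PP') (auto simp: P''_def)
    then have "smult c G = P'' * ([:content P * lead_coeff P':] * Q)"
      using c(2) by (metis mult.assoc)
    with c(1) show ?thesis by blast
  qed
  moreover have "degree P'' \<le> degree G" if "ev G w = 0" "G \<noteq> 0" for G
    using min[OF that] lc by (auto simp: P''_def P'_def)
  ultimately show thesis using that by blast
qed

text \<open>\<open>H\<close> is the set of Galois conjugates of \<open>w\<close>, and the last property holds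
  because the norm of a nonzero element of \<open>\<int>[w]\<close> is a nonzero integer.\<close>

theorem conjugates_of_root_of_unity:
  assumes N: "N > 0" "w ^ N = 1" and ord: "\<And>d. 0 < d \<Longrightarrow> d < N \<Longrightarrow> w ^ d \<noteq> 1"
  obtains H where "finite H" "w \<in> H"
    "\<And>z f. z \<in> H \<Longrightarrow> ev f z = 0 \<longleftrightarrow> ev f w = 0"
    "\<And>f. ev f w \<noteq> 0 \<Longrightarrow> norm (\<Prod>z\<in>H. ev f z) \<ge> 1"
proof -
  obtain P where lc: "lead_coeff P = 1" and Pw: "ev P w = 0" and dvdX: "P dvd monom 1 N - 1"
    and dv: "\<And>G. ev G w = 0 \<Longrightarrow> \<exists>c Q. c \<noteq> 0 \<and> smult c G = P * Q"
    and min: "\<And>G. ev G w = 0 \<Longrightarrow> G \<noteq> 0 \<Longrightarrow> degree P \<le> degree G"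
    using monic_minimal_int_poly[OF N] by metis
  have P0: "P \<noteq> 0" using lc by auto
  obtain R where R: "monom 1 N - 1 = P * R" using dvdX by blast
  define H where "H = {z. ev P z = 0}"
  have evX: "z ^ N - 1 = ev P z * ev R z" for z
    using arg_cong[OF R, of "\<lambda>f. ev f z"] by simp
  have HN: "z ^ N = 1" if "z \<in> H" for z
    using evX[of z] that by (simp add: H_def)
  have finH: "finite H"
    by (rule finite_subset[OF _ finite_roots_unity[of N]]) (use HN N in auto)
  have wH: "w \<in> H" using Pw by (simp add: H_def)
  have up: "ev G z = 0" if z: "z \<in> H" and G: "ev G w = 0" for z G
  proof -
    obtain c Q where c: "c \<noteq> 0" "smult c G = P * Q" using dv[OF G] by blast
    have "of_int c * ev G z = ev P z * ev Q z"
      using arg_cong[OF c(2), of "\<lambda>f. ev f z"] by simp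
    then show ?thesis using z c by (simp add: H_def)
  qed
  \<comment> \<open>Irreducibility: a minimal polynomial \<open>P'\<close> of \<open>z\<close>
    divides \<open>P\<close> up to a constant. If the cofactor \<open>Q\<close> vanished at
    \<open>w\<close>, its degree would be at least that of \<open>P\<close>, leaving
    \<open>P'\<close> constant. So \<open>P'\<close> vanishes at \<open>w\<close>.\<close>
  have down: "ev G w = 0" if z: "z \<in> H" and G: "ev G z = 0" for z G
  proof -
    have Pz: "ev P z = 0" using z by (simp add: H_def)
    obtain P' where P': "P' \<noteq> 0" "ev P' z = 0" "degree P' \<le> degree P"
      and dv': "\<And>G. ev G z = 0 \<Longrightarrow> \<exists>c Q. c \<noteq> 0 \<and> smult c G = P' * Q"
      by (rule minimal_int_poly[OF P0 Pz], rule that, assumption+)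
    from dv'[OF Pz] obtain c Q where c: "c \<noteq> 0" "smult c P = P' * Q" by blast
    have Q0: "Q \<noteq> 0" using c P0 by auto
    have "ev P' w * ev Q w = 0" using arg_cong[OF c(2), of "\<lambda>f. ev f w"] Pw by simp
    moreover have "ev Q w \<noteq> 0"
    proof
      assume "ev Q w = 0"
      then have "degree P \<le> degree Q" using min Q0 by blast
      moreover have "degree P = degree P' + degree Q"
        using arg_cong[OF c(2), of degree] c(1) P'(1) Q0 by (simp add: degree_mult_eq)
      ultimately have "degree P' = 0" by simp
      then obtain a where "P' = [:a:]" by (rule degree_eq_zeroE)
      then show False using P' by simp
    qed
    ultimately have P'w: "ev P' w = 0" by simp
    from dv'[OF G] obtain d S where d: "d \<noteq> 0" "smult d G = P' * S" by blast
    show ?thesis using arg_cong[OF d(2), of "\<lambda>f. ev f w"] P'w d(1) by simp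
  qed
  have iff: "ev f z = 0 \<longleftrightarrow> ev f w = 0" if "z \<in> H" for z f
    using up down that by blast
  have ordH: "z ^ d \<noteq> 1" if "z \<in> H" "0 < d" "d < N" for z d
  proof
    assume "z ^ d = 1"
    then have "ev (monom 1 d - 1) z = 0" by simp
    then have "ev (monom 1 d - 1) w = 0" using iff[OF that(1)] by blast
    with ord that show False by simp
  qed
  \<comment> \<open>\<open>P\<close> divides \<open>monom 1 N - 1\<close>, which shares no root with
    its derivative, so \<open>P\<close> has as many distinct roots as its degree.\<close>
  have card: "degree P \<le> card H"
  proof -
    define p :: "complex poly" where "p = map_poly of_int P"
    have ev_p: "ev P z = poly p z" for z unfolding ev_def p_def by (rule HOL.refl)
    have deg: "degree p = degree P" by (simp add: p_def degree_map_poly)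
    have "coeff p (degree P) = 1" using lc by (simp add: p_def coeff_map_poly)
    then have p0: "p \<noteq> 0" by auto
    have "rsquarefree p"
    proof (subst rsquarefree_roots, intro allI notI)
      fix a assume a: "poly p a = 0 \<and> poly (pderiv p) a = 0"
      define r :: "complex poly" where "r = map_poly of_int R"
      have eq: "monom 1 N - 1 = p * r"
        by (rule poly_eq_poly_eq_iff[THEN iffD1], rule ext) (use evX in \<open>simp add: p_def r_def ev_def poly_monom\<close>)
      have "poly (pderiv (monom 1 N - 1)) a = 0"
        unfolding eq using a by (simp add: pderiv_mult)
      then have "of_nat N * a ^ (N - 1) = 0"
        by (simp add: pderiv_diff pderiv_monom poly_monom)
      then have "a = 0" using N by simp
      moreover have "a ^ N = 1" using HN[of a] a by (simp add: H_def ev_p)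
      ultimately show False using N by (simp add: power_0_left)
    qed
    then have "smult (lead_coeff p) (\<Prod>z|poly p z = 0. [:-z, 1:]) = p"
      by (rule complex_poly_decompose_rsquarefree)
    then have "degree p = degree (\<Prod>z|poly p z = 0. [:-z, 1:])"
      using p0 by (metis degree_smult_eq leading_coeff_0_iff)
    also have "\<dots> = card {z. poly p z = 0}" 
      by (subst degree_prod_sum_eq) auto
    finally show ?thesis by (simp add: deg H_def ev_p)
  qed
  have norm_int: "\<exists>a::int. (\<Prod>z\<in>H. ev f z) = of_int a" for f
  proof -
    define J where "J = {s. s < N \<and> w ^ s \<in> H}"
    have HJ: "(\<lambda>s. w ^ s) ` J = H" 
      using powers_of_primitive_root(2)[OF N ord] HN by (auto simp: J_def)
    have injJ: "inj_on (\<lambda>s. w ^ s) J"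
      by (rule inj_on_subset[OF powers_of_primitive_root(1)[OF N ord]]) (auto simp: J_def)
    have finJ: "finite J" by (simp add: J_def)
    \<comment> \<open>\<open>J\<close> lists the exponents of the conjugates of \<open>w\<close>.
      Raising any \<open>z\<close> in \<open>H\<close> to these exponents runs through
      \<open>H\<close> once, so \<open>F\<close> takes the same value, the norm, at every
      conjugate.\<close>
    define F where "F = (\<Prod>s\<in>J. pcompose f (monom 1 s))"
    have F: "ev F z = (\<Prod>z\<in>H. ev f z)" if z: "z \<in> H" for z
    proof -
      have sub: "(\<lambda>s. z ^ s) ` J \<subseteq> H"
      proof safe
        fix s assume "s \<in> J"
        then have "ev (pcompose P (monom 1 s)) w = 0" by (simp add: J_def H_def ev_pcompose)
        then have "ev (pcompose P (monom 1 s)) z = 0" using iff[OF z] by blast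
        then show "z ^ s \<in> H" by (simp add: H_def ev_pcompose)
      qed
      have inj: "inj_on (\<lambda>s. z ^ s) J"
        by (rule inj_on_subset[OF powers_of_primitive_root(1)[OF N(1) HN[OF z] ordH[OF z]]])
          (auto simp: J_def)
      have "(\<lambda>s. z ^ s) ` J = H"
        using card_subset_eq[OF finH sub] card_image[OF inj] card_image[OF injJ] HJ by simp
      then have "(\<Prod>z\<in>H. ev f z) = (\<Prod>s\<in>J. ev f (z ^ s))"
        using prod.reindex[OF inj, of "ev f"] by simp
      then show ?thesis by (simp add: F_def ev_prod ev_pcompose)
    qed
    obtain a Q where a: "smult (lead_coeff P ^ a) F = P * Q + pseudo_mod F P"
      unfolding pseudo_mod_def using pseudo_divmod(1)[OF P0, of F] by (metis prod.collapse)
    define r where "r = pseudo_mod F P"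
    have deg_r: "r = 0 \<or> degree r < degree P" using pseudo_mod(2)[OF P0] by (simp add: r_def)
    define g where "g = (\<Prod>z\<in>H. ev f z)"
    have r: "ev r z = g" if "z \<in> H" for z
      using arg_cong[OF a, of "\<lambda>f. ev f z"] F[OF that] that lc by (simp add: r_def g_def H_def)
    \<comment> \<open>As \<open>P\<close> is monic, \<open>r\<close> is the true remainder of
      \<open>F\<close>. It takes the value \<open>g\<close> on all of \<open>H\<close>, which has
      more points than the degree of \<open>r\<close>; so it is constant and \<open>g\<close> is an
      integer.\<close>
    define q where "q = map_poly of_int r - [:g:]"
    have "degree q < card H"
    proof -
      have "0 < card H" using finH wH by (auto simp: card_gt_0_iff)
      have "degree q \<le> degree r"
        unfolding q_def by (intro degree_diff_le) (simp_all add: degree_map_poly)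
      with deg_r card \<open>0 < card H\<close> show ?thesis by auto
    qed
    moreover have "H \<subseteq> {z. poly q z = 0}" using r by (auto simp: q_def ev_def)
    ultimately have "q = 0"
      using card_mono[OF poly_roots_finite[of q], of H] card_poly_roots_bound[of q] by force
    then have "poly (map_poly of_int r) 0 = g" by (simp add: q_def)
    then have "g = of_int (coeff r 0)" by (simp add: poly_0_coeff_0 coeff_map_poly)
    then show ?thesis unfolding g_def by blast
  qed
  have "norm (\<Prod>z\<in>H. ev f z) \<ge> 1" if "ev f w \<noteq> 0" for f
  proof -
    obtain a :: int where a: "(\<Prod>z\<in>H. ev f z) = of_int a" using norm_int by blast
    have "(\<Prod>z\<in>H. ev f z) \<noteq> 0" using finH iff that by simp
    then have "a \<noteq> 0" using a by auto
    then show ?thesis unfolding a by simp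
  qed
  then show thesis using that finH wH iff by blast
qed

section \<open>Orbits of triples and bounded real orbits\<close>

text \<open>These are the two braid generators and their inverses after changing two signs. The ring
  is left open because orbits of integer polynomials, real and complex triples are all
  needed.\<close>

inductive_set orb :: "'a::comm_ring_1 \<times> 'a \<times> 'a \<Rightarrow> ('a \<times> 'a \<times> 'a) set" for t where
  orb_base: "t \<in> orb t"
| orb_1: "(x, y, z) \<in> orb t \<Longrightarrow> (x, x * y - z, y) \<in> orb t"
| orb_1': "(x, y, z) \<in> orb t \<Longrightarrow> (x, z, x * z - y) \<in> orb t"
| orb_2: "(x, y, z) \<in> orb t \<Longrightarrow> (z, y, y * z - x) \<in> orb t"
| orb_2': "(x, y, z) \<in> orb t \<Longrightarrow> (x * y - z, y, x) \<in> orb t"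

fun markov :: "'a::comm_ring_1 \<times> 'a \<times> 'a \<Rightarrow> 'a" where
  "markov (x, y, z) = x\<^sup>2 + y\<^sup>2 + z\<^sup>2 - x * y * z"

definition map3 :: "('a \<Rightarrow> 'b) \<Rightarrow> 'a \<times> 'a \<times> 'a \<Rightarrow> 'b \<times> 'b \<times> 'b" where
  "map3 h = map_prod h (map_prod h h)"

lemma map3_simp [simp]: "map3 h (x, y, z) = (h x, h y, h z)"
  by (simp add: map3_def)

lemma orb_trans:
  assumes "s \<in> orb t" "r \<in> orb s" shows "r \<in> orb t"
  using assms(2,1) by induction (auto intro: orb.intros)

lemma orb_sym:
  assumes "s \<in> orb t" shows "t \<in> orb s"
  using assms
proof induction
  case (orb_1 x y z)
  have "(x, y, z) \<in> orb (x, x * y - z, y)"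
    using orb.orb_1'[OF orb.orb_base, where x = x and y = "x * y - z" and z = y] by (simp add: mult.commute)
  from orb_trans[OF this orb_1(2)] show ?case .
next
  case (orb_1' x y z)
  have "(x, y, z) \<in> orb (x, z, x * z - y)"
    using orb.orb_1[OF orb.orb_base, where x = x and y = z and z = "x * z - y"] by (simp add: mult.commute)
  from orb_trans[OF this orb_1'(2)] show ?case .
next
  case (orb_2 x y z)
  have "(x, y, z) \<in> orb (z, y, y * z - x)"
    using orb.orb_2'[OF orb.orb_base, where x = z and y = y and z = "y * z - x"] by (simp add: mult.commute)
  from orb_trans[OF this orb_2(2)] show ?case .
next
  case (orb_2' x y z)
  have "(x, y, z) \<in> orb (x * y - z, y, x)"
    using orb.orb_2[OF orb.orb_base, where x = "x * y - z" and y = y and z = x] by (simp add: mult.commute)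
  from orb_trans[OF this orb_2'(2)] show ?case .
qed (rule orb.orb_base)

lemma orb_coords:
  assumes "(x, y, z) \<in> orb t"
  shows "\<exists>u v. (y, u, v) \<in> orb t" "\<exists>u v. (z, u, v) \<in> orb t"
  using orb_2[OF assms] orb_2[OF orb_1[OF assms]] by blast+

lemma markov_orb: "s \<in> orb t \<Longrightarrow> markov s = markov t"
  by (induction rule: orb.induct) (simp_all add: power2_eq_square algebra_simps)

text \<open>The moves use only products and differences. The maps that matter are evaluation of
  integer polynomials at a conjugate and the embedding of the reals.\<close>

lemma orb_hom:
  assumes "\<And>x y. h (x - y) = h x - h y" "\<And>x y. h (x * y) = h x * h y"
  shows "orb (map3 h t) = map3 h ` orb t"
proof (intro equalityI subsetI)
  fix s assume "s \<in> orb (map3 h t)"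
  then show "s \<in> map3 h ` orb t"
  proof induction
    case (orb_1 x y z)
    then obtain a b c where "(a, b, c) \<in> orb t" "x = h a" "y = h b" "z = h c" by auto
    then show ?case by (intro image_eqI[OF _ orb.orb_1[of a b c]]) (simp_all add: assms)
  next
    case (orb_1' x y z)
    then obtain a b c where "(a, b, c) \<in> orb t" "x = h a" "y = h b" "z = h c" by auto
    then show ?case by (intro image_eqI[OF _ orb.orb_1'[of a b c]]) (simp_all add: assms)
  next
    case (orb_2 x y z)
    then obtain a b c where "(a, b, c) \<in> orb t" "x = h a" "y = h b" "z = h c" by auto
    then show ?case by (intro image_eqI[OF _ orb.orb_2[of a b c]]) (simp_all add: assms)
  next
    case (orb_2' x y z)
    then obtain a b c where "(a, b, c) \<in> orb t" "x = h a" "y = h b" "z = h c" by auto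
    then show ?case by (intro image_eqI[OF _ orb.orb_2'[of a b c]]) (simp_all add: assms)
  qed (simp add: orb.orb_base)
next
  fix s assume "s \<in> map3 h ` orb t"
  then obtain r where r: "r \<in> orb t" and s: "s = map3 h r" by blast
  from r have "map3 h r \<in> orb (map3 h t)"
    by induction (use assms in \<open>auto intro: orb.intros\<close>)
  then show "s \<in> orb (map3 h t)" by (simp add: s)
qed

text \<open>Fixing \<open>x\<close>, the pairs \<open>(y, z)\<close> run along a conic. At a point where \<open>\<bar>y\<bar>\<close> is almost
  maximal, one of the two neighbours \<open>u \<in> {z, x * y - z}\<close> satisfies \<open>x * y * u \<ge> x\<^sup>2 * y\<^sup>2 / 2\<close>.\<close>

lemma bounded_conic_orbit:
  fixes t :: "real \<times> real \<times> real"
  assumes bd: "\<And>y z. (x, y, z) \<in> orb t \<Longrightarrow> \<bar>y\<bar> \<le> V" and x: "\<bar>x\<bar> \<le> 2"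
    and ex: "(x, y0, z0) \<in> orb t"
  shows "markov t - x\<^sup>2 \<le> V\<^sup>2 * (2 - \<bar>x\<bar>)"
proof -
  define S where "S = {\<bar>y\<bar> |y z. (x, y, z) \<in> orb t}"
  define B where "B = Sup S"
  have S: "S \<noteq> {}" "bdd_above S" using ex bd by (auto simp: S_def intro!: bdd_aboveI)
  have B: "\<bar>y\<bar> \<le> B" if "(x, y, z) \<in> orb t" for y z
    unfolding B_def by (rule cSup_upper[OF _ S(2)]) (use that in \<open>auto simp: S_def\<close>)
  have B0: "0 \<le> B" using B[OF ex] by linarith
  have BV: "B \<le> V" unfolding B_def using S(1) by (rule cSup_least) (auto simp: S_def bd)
  have "markov t - x\<^sup>2 \<le> B\<^sup>2 * (2 - \<bar>x\<bar>) + e" if "e > 0" for e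
  proof -
    define d where "d = e / (2 * (B + 1))"
    have d: "d > 0" "2 * B * d \<le> e" using that B0 by (auto simp: d_def field_simps)
    have "\<exists>s\<in>S. B - d < s"
      using less_cSup_iff[OF S, of "B - d"] d by (simp add: B_def)
    then obtain y z where yz: "(x, y, z) \<in> orb t" "B - d < \<bar>y\<bar>" by (auto simp: S_def)
    have w: "(x, x * y - z, y) \<in> orb t" "(x, z, x * z - y) \<in> orb t"
      using yz by (auto intro: orb.intros)
    have "x * y * z + x * y * (x * y - z) = x\<^sup>2 * y\<^sup>2"
      by (simp add: power2_eq_square algebra_simps)
    then have "x * y * z \<ge> x\<^sup>2 * y\<^sup>2 / 2 \<or> x * y * (x * y - z) \<ge> x\<^sup>2 * y\<^sup>2 / 2" by linarith
    then obtain u where u: "u = z \<or> u = x * y - z" "x * y * u \<ge> x\<^sup>2 * y\<^sup>2 / 2" by blast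
    have uB: "\<bar>u\<bar> \<le> B" using B w u(1) by blast
    have yB: "\<bar>y\<bar> \<le> B" using B yz by blast
    have E: "markov t - x\<^sup>2 = y\<^sup>2 + u\<^sup>2 - x * y * u"
    proof -
      have "markov t = x\<^sup>2 + y\<^sup>2 + z\<^sup>2 - x * y * z" using markov_orb[OF yz(1)] by simp
      with u(1) show ?thesis
        by (elim disjE; hypsubst) (simp_all add: power2_eq_square algebra_simps)
    qed
    have xyu: "x * y * u = \<bar>x\<bar> * \<bar>y\<bar> * \<bar>u\<bar>"
    proof -
      have "0 \<le> x\<^sup>2 * y\<^sup>2 / 2" by simp
      then have "0 \<le> x * y * u" using u(2) by linarith
      then show ?thesis by (simp flip: abs_mult)
    qed
    have half: "\<bar>x\<bar> * \<bar>y\<bar> / 2 \<le> \<bar>u\<bar> \<or> \<bar>x\<bar> * \<bar>y\<bar> = 0"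
    proof (cases "\<bar>x\<bar> * \<bar>y\<bar> = 0")
      case False
      then have "0 < \<bar>x\<bar> * \<bar>y\<bar>" by simp
      moreover have "(\<bar>x\<bar> * \<bar>y\<bar>) * (\<bar>x\<bar> * \<bar>y\<bar> / 2) \<le> (\<bar>x\<bar> * \<bar>y\<bar>) * \<bar>u\<bar>"
        using u(2) xyu by (simp add: power2_eq_square) (simp add: abs_if algebra_simps split: if_splits)
      ultimately show ?thesis using mult_le_cancel_left_pos by blast
    qed simp
    have "\<bar>x\<bar> * \<bar>y\<bar> \<le> 2 * B" using x yB by (intro mult_mono) auto
    \<comment> \<open>The quadratic \<open>s\<^sup>2 - \<bar>x * y\<bar> * s\<close> increases once
      \<open>s\<close> exceeds half of \<open>\<bar>x * y\<bar>\<close>, so its value at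
      \<open>\<bar>u\<bar>\<close> is at most its value at \<open>B\<close>.\<close>
    with half uB have "0 \<le> (B - \<bar>u\<bar>) * (B + \<bar>u\<bar> - \<bar>x\<bar> * \<bar>y\<bar>)"
      by (intro mult_nonneg_nonneg) auto
    then have 1: "u\<^sup>2 - x * y * u \<le> B\<^sup>2 - \<bar>x\<bar> * \<bar>y\<bar> * B"
      unfolding xyu by (simp add: power2_eq_square algebra_simps)
    have 2: "y\<^sup>2 \<le> B\<^sup>2" using yB power_mono[of "\<bar>y\<bar>" B 2] by simp
    have "\<bar>x\<bar> * B * (B - d) \<le> \<bar>x\<bar> * B * \<bar>y\<bar>"
      using yz B0 by (intro mult_left_mono) auto
    moreover have "\<bar>x\<bar> * B * d \<le> 2 * B * d" using x B0 d by (intro mult_right_mono) auto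
    ultimately have "\<bar>x\<bar> * B * B - e \<le> \<bar>x\<bar> * \<bar>y\<bar> * B"
      using d by (simp add: algebra_simps)
    with 1 2 show ?thesis unfolding E by (simp add: power2_eq_square algebra_simps)
  qed
  then have "markov t - x\<^sup>2 \<le> B\<^sup>2 * (2 - \<bar>x\<bar>)" by (rule field_le_epsilon)
  also have "\<dots> \<le> V\<^sup>2 * (2 - \<bar>x\<bar>)"
    using BV B0 x by (intro mult_right_mono power_mono) auto
  finally show ?thesis .
qed

text \<open>With \<open>\<bar>x\<bar>\<close> close to the supremum \<open>V\<close> of all
  \<open>\<bar>x\<bar>\<close> in the orbit, the conic bound tends to
  \<open>V\<^sup>2 * (3 - V)\<close>, which equals
  \<open>4 - (V - 2)\<^sup>2 * (V + 1)\<close>.\<close>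

lemma bounded_orbit_markov_le_4:
  fixes t :: "real \<times> real \<times> real"
  assumes bd: "\<And>x y z. (x, y, z) \<in> orb t \<Longrightarrow> \<bar>x\<bar> \<le> 2"
  shows "markov t \<le> 4"
proof -
  define S where "S = {\<bar>x\<bar> |x y z. (x, y, z) \<in> orb t}"
  define V where "V = Sup S"
  obtain a b c where t: "t = (a, b, c)" by (cases t)
  have abc: "(a, b, c) \<in> orb t" unfolding t by (rule orb_base)
  have S: "S \<noteq> {}" "bdd_above S" using abc bd by (auto simp: S_def intro!: bdd_aboveI)
  have V: "\<bar>x\<bar> \<le> V" if "(x, y, z) \<in> orb t" for x y z
    unfolding V_def by (rule cSup_upper[OF _ S(2)]) (use that in \<open>auto simp: S_def\<close>)
  have V2: "V \<le> 2" unfolding V_def using S(1) by (rule cSup_least) (auto simp: S_def bd)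
  have V0: "0 \<le> V" using V[OF abc] by linarith
  have "markov t \<le> V\<^sup>2 * (3 - V) + e" if e: "e > 0" for e
  proof -
    have "\<exists>s\<in>S. V - e / 4 < s"
      using less_cSup_iff[OF S, of "V - e / 4"] e by (simp add: V_def)
    then obtain x y z where xyz: "(x, y, z) \<in> orb t" "V - e / 4 < \<bar>x\<bar>" by (auto simp: S_def)
    have "\<bar>y'\<bar> \<le> V" if "(x, y', z') \<in> orb t" for y' z'
      using orb_coords(1)[OF that] V by blast
    then have "markov t - x\<^sup>2 \<le> V\<^sup>2 * (2 - \<bar>x\<bar>)"
      by (rule bounded_conic_orbit) (use xyz bd in auto)
    moreover have "V\<^sup>2 * (2 - \<bar>x\<bar>) \<le> V\<^sup>2 * (2 - V + e / 4)"
      using xyz by (intro mult_left_mono) auto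
    moreover have "V\<^sup>2 * (e / 4) \<le> 4 * (e / 4)"
      using V2 V0 e power_mono[of V 2 2] by (intro mult_right_mono) auto
    moreover have "x\<^sup>2 \<le> V\<^sup>2" using V[OF xyz(1)] power_mono[of "\<bar>x\<bar>" V 2] by simp
    ultimately show ?thesis by (simp add: algebra_simps)
  qed
  then have "markov t \<le> V\<^sup>2 * (3 - V)" by (rule field_le_epsilon)
  also have "\<dots> \<le> 4"
  proof -
    have "0 \<le> (V - 2)\<^sup>2 * (V + 1)" using V0 by simp
    then show ?thesis by (simp add: power2_eq_square algebra_simps)
  qed
  finally show ?thesis .
qed

section \<open>Orbits of doubled cosines of rational angles\<close>

definition two_cos :: "complex set" where
  "two_cos = {z + inverse z |z. \<exists>n>0. z ^ n = 1}"

text \<open>Dickson polynomials (rescaled Chebyshev polynomials) send \<open>z + inverse z\<close>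
  to \<open>z ^ n + inverse z ^ n\<close>. They turn membership in \<open>two_cos\<close> into the
  equation \<open>ev (dickson n) x = 2\<close>, which conjugation preserves.\<close>

fun dickson :: "nat \<Rightarrow> int poly" where
  "dickson 0 = 2"
| "dickson (Suc 0) = [:0, 1:]"
| "dickson (Suc (Suc n)) = [:0, 1:] * dickson (Suc n) - dickson n"

lemma ev_dickson:
  assumes "z \<noteq> 0" shows "ev (dickson n) (z + inverse z) = z ^ n + inverse z ^ n"
  using assms by (induction n rule: dickson.induct) (simp_all add: field_simps)

lemma ev_dickson_two_cos:
  assumes "x \<in> two_cos" shows "\<exists>n>0. ev (dickson n) x = 2"
proof -
  from assms obtain z n where z: "n > 0" "z ^ n = 1" "x = z + inverse z" 
    by (auto simp: two_cos_def)
  then have "z \<noteq> 0" by (auto simp: power_0_left)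
  with z show ?thesis by (auto simp: ev_dickson power_inverse)
qed

text \<open>Every \<open>x\<close> is \<open>z + inverse z\<close> for a root \<open>z\<close> of a
  quadratic, and \<open>z ^ n + inverse (z ^ n) = 2\<close> amounts to
  \<open>(z ^ n - 1)\<^sup>2 = 0\<close>.\<close>

lemma two_cosI_dickson:
  assumes "n > 0" "ev (dickson n) x = 2" shows "x \<in> two_cos"
proof -
  define z where "z = (x + csqrt (x\<^sup>2 - 4)) / 2"
  have q: "z * z = x * z - 1"
  proof -
    have "2 * z - x = csqrt (x\<^sup>2 - 4)" by (simp add: z_def field_simps)
    then have "(2 * z - x)\<^sup>2 = x\<^sup>2 - 4" by simp
    then have "4 * (z * z) = 4 * (x * z - 1)" by (simp add: power2_eq_square algebra_simps)
    then show ?thesis using mult_left_cancel[of 4 "z * z"] by fastforce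
  qed
  then have z0: "z \<noteq> 0" by auto
  with q have x: "x = z + inverse z" by (simp add: field_simps)
  have "z ^ n + inverse (z ^ n) = 2"
    using assms(2) z0 by (simp add: x ev_dickson power_inverse)
  then have "(z ^ n - 1)\<^sup>2 = 0"
    using z0 by (simp add: field_simps power2_eq_square)
  then show ?thesis using assms(1) x by (auto simp: two_cos_def)
qed

lemma two_cos_real:
  assumes "x \<in> two_cos" obtains r :: real where "x = of_real r" "\<bar>r\<bar> \<le> 2"
proof -
  from assms obtain z n where z: "n > 0" "z ^ n = 1" "x = z + inverse z" 
    by (auto simp: two_cos_def)
  then have "norm z ^ n = 1" by (metis norm_one norm_power)
  then have "norm z = 1" using z(1) power_eq_1_iff by (metis norm_ge_zero power_eq_imp_eq_base power_one zero_le_one)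
  then have "inverse z = cnj z" 
    by (metis complex_norm_square inverse_unique mult.commute of_real_1 power_one)
  then have "x = of_real (2 * Re z)" using z(3) by (simp add: complex_eq_iff)
  moreover have "\<bar>2 * Re z\<bar> \<le> 2" using abs_Re_le_cmod[of z] \<open>norm z = 1\<close> by simp
  ultimately show thesis by (rule that)
qed

lemma two_cos_uminus: "x \<in> two_cos \<Longrightarrow> - x \<in> two_cos"
proof -
  assume "x \<in> two_cos"
  then obtain z n where z: "n > 0" "z ^ n = 1" "x = z + inverse z" 
    by (auto simp: two_cos_def)
  then have "(- z) ^ (2 * n) = 1" "- x = (- z) + inverse (- z)"
    by (simp_all add: power_mult power2_eq_square power_mult_distrib)
  then show ?thesis using z(1) unfolding two_cos_def by (metis (mono_tags, lifting) mem_Collect_eq nat_0_less_mult_iff zero_less_numeral)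
qed

lemma two_cos_cos_Rats:
  assumes "r \<in> \<rat>" shows "complex_of_real (2 * cos (pi * r)) \<in> two_cos"
proof -
  obtain a b where b: "b > 0" and r: "r = of_int a / of_nat b"
    using Rats_cases'[OF assms] by (metis of_int_of_nat_eq zero_less_imp_eq_int of_nat_0_less_iff)
  define z where "z = cis (pi * r)"
  have "real (2 * b) * (pi * r) = 2 * pi * of_int a" using b by (simp add: r)
  then have "z ^ (2 * b) = cis (2 * pi * of_int a)"
    unfolding z_def DeMoivre by (rule arg_cong)
  also have "\<dots> = 1" by (rule cis_multiple_2pi) simp
  finally have "z ^ (2 * b) = 1" .
  moreover have "of_real (2 * cos (pi * r)) = z + inverse z"
    by (simp add: z_def complex_eq_iff)
  ultimately show ?thesis using b by (auto simp: two_cos_def intro!: exI[of _ z] exI[of _ "2 * b"])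
qed

text \<open>The consequence of goodness that survives Galois conjugation; by
  \<open>orb_coords\<close>, testing first coordinates tests all of them.\<close>

definition cos_orbit :: "complex \<times> complex \<times> complex \<Rightarrow> bool" where
  "cos_orbit t \<longleftrightarrow> (\<forall>(x, y, z)\<in>orb t. x \<in> two_cos)"

lemma cos_orbitD:
  assumes "cos_orbit t" "(x, y, z) \<in> orb t"
  shows "x \<in> two_cos" "y \<in> two_cos" "z \<in> two_cos"
  using assms orb_coords[OF assms(2)] unfolding cos_orbit_def by fast+

lemma cos_orbit_orb: "cos_orbit t \<Longrightarrow> s \<in> orb t \<Longrightarrow> cos_orbit s"
  unfolding cos_orbit_def using orb_trans by blast

text \<open>An orbit entry at \<open>w\<close> is \<open>ev f w\<close> for a polynomial
  \<open>f\<close> in the orbit of \<open>F\<close>. That it is a doubled cosine means that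
  \<open>pcompose (dickson n) f - 2\<close> vanishes at \<open>w\<close>, and then it vanishes at
  \<open>z\<close> too.\<close>

lemma cos_orbit_conjugate:
  assumes conj: "\<And>f. ev f w = 0 \<Longrightarrow> ev f z = 0"
    and co: "cos_orbit (map3 (\<lambda>f. ev f w) F)"
  shows "cos_orbit (map3 (\<lambda>f. ev f z) F)"
  unfolding cos_orbit_def
proof (intro ballI, clarify)
  fix a b c assume "(a, b, c) \<in> orb (map3 (\<lambda>f. ev f z) F)"
  moreover have "orb (map3 (\<lambda>f. ev f z) F) = map3 (\<lambda>f. ev f z) ` orb F"
    by (rule orb_hom) simp_all
  ultimately obtain f g h where fgh: "(f, g, h) \<in> orb F" "a = ev f z" by auto
  have "orb (map3 (\<lambda>f. ev f w) F) = map3 (\<lambda>f. ev f w) ` orb F"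
    by (rule orb_hom) simp_all
  with fgh have "(ev f w, ev g w, ev h w) \<in> orb (map3 (\<lambda>f. ev f w) F)"
    by (metis image_eqI map3_simp)
  with co have "ev f w \<in> two_cos" by (rule cos_orbitD)
  then obtain n where n: "n > 0" "ev (dickson n) (ev f w) = 2" using ev_dickson_two_cos by blast
  have "ev (pcompose (dickson n) f - 2) w = 0" using n by (simp add: ev_pcompose)
  then have "ev (pcompose (dickson n) f - 2) z = 0" by (rule conj)
  then show "a \<in> two_cos" using n(1) fgh by (auto simp: ev_pcompose intro!: two_cosI_dickson)
qed

lemma cos_orbit_real:
  assumes "cos_orbit t" 
  obtains r :: "real \<times> real \<times> real" where "t = map3 of_real r" "markov r \<le> 4"
proof -
  obtain x y z where t: "t = (x, y, z)" by (cases t)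
  have "x \<in> two_cos" "y \<in> two_cos" "z \<in> two_cos"
    using cos_orbitD[OF assms] orb_base[of t] unfolding t by blast+
  then obtain a b c :: real where abc: "x = of_real a" "y = of_real b" "z = of_real c" 
    by (metis two_cos_real)
  define r where "r = (a, b, c)"
  have tr: "t = map3 of_real r" by (simp add: t r_def abc)
  have hom: "orb t = map3 of_real ` orb r" unfolding tr by (rule orb_hom) simp_all
  have "markov r \<le> 4"
  proof (rule bounded_orbit_markov_le_4)
    fix x y z assume "(x, y, z) \<in> orb r"
    then have "map3 complex_of_real (x, y, z) \<in> orb t" unfolding hom by (rule imageI)
    then have "complex_of_real x \<in> two_cos" using cos_orbitD(1)[OF assms] by simp
    then show "\<bar>x\<bar> \<le> 2" by (metis of_real_eq_iff two_cos_real)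
  qed
  with tr that show thesis by blast
qed

section \<open>Norms of cyclotomic differences and rotations about a coordinate\<close>

definition primitive_root_of_unity :: "complex \<Rightarrow> nat \<Rightarrow> bool" where
  "primitive_root_of_unity w m \<longleftrightarrow> m > 0 \<and> w ^ m = 1 \<and> (\<forall>d. 0 < d \<and> d < m \<longrightarrow> w ^ d \<noteq> 1)"

lemma primitive_root_of_unity_exists:
  assumes "n > 0" "w ^ n = 1" obtains m where "primitive_root_of_unity w m"
  using exists_least_iff[of "\<lambda>m. m > 0 \<and> w ^ m = 1"] assms
  unfolding primitive_root_of_unity_def by (metis (no_types, lifting))

lemma primitive_root_powers:
  assumes "primitive_root_of_unity w m"
  shows "inj_on (\<lambda>k. w ^ k) {..<m}" "{z. z ^ m = 1} = (\<lambda>k. w ^ k) ` {..<m}"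
  using powers_of_primitive_root[of m w] assms by (auto simp: primitive_root_of_unity_def)

lemma primitive_root_of_unity_power:
  assumes "primitive_root_of_unity w (p * j)"
  shows "primitive_root_of_unity (w ^ p) j"
  using assms by (auto simp: primitive_root_of_unity_def simp flip: power_mult)

lemma prod_linear_roots_of_unity:
  assumes "m > 0"
  shows "(\<Prod>z | z ^ m = 1. [:- z, 1:]) = (monom 1 m - 1 :: complex poly)"
proof -
  define X :: "complex poly" where "X = monom 1 m - 1"
  have cX: "coeff X m = 1" using assms by (simp add: X_def)
  have "degree X \<le> m" unfolding X_def by (rule degree_diff_le) (simp_all add: degree_monom_le)
  moreover have "m \<le> degree X" by (rule le_degree) (simp add: cX)
  ultimately have deg: "degree X = m" by simp
  have pX: "poly X z = z ^ m - 1" for z by (simp add: X_def poly_monom)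
  have "rsquarefree X"
  proof (subst rsquarefree_roots, intro allI notI)
    fix a assume a: "poly X a = 0 \<and> poly (pderiv X) a = 0"
    then have "of_nat m * a ^ (m - 1) = 0"
      by (simp add: X_def pderiv_diff pderiv_monom poly_monom)
    then have "a = 0" using assms by simp
    with a assms show False by (simp add: pX power_0_left)
  qed
  from complex_poly_decompose_rsquarefree[OF this] show ?thesis
    by (simp add: pX deg cX flip: X_def)
qed

lemma prod_primitive_root:
  assumes "primitive_root_of_unity w m"
  shows "(\<Prod>k<m. [:- (w ^ k), 1:]) = monom 1 m - 1"
  using prod_linear_roots_of_unity[of m] primitive_root_powers[OF assms] assms
  by (simp add: prod.reindex primitive_root_of_unity_def)

lemma prod_primitive_root_homogeneous:
  assumes "primitive_root_of_unity w m"
  shows "(\<Prod>k<m. x - y * w ^ k) = x ^ m - y ^ m"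
proof (cases "y = 0")
  case True
  then show ?thesis using assms by (simp add: primitive_root_of_unity_def power_0_left)
next
  case False
  have "(\<Prod>k<m. x / y - w ^ k) = (x / y) ^ m - 1"
    using arg_cong[OF prod_primitive_root[OF assms], of "\<lambda>f. poly f (x / y)"]
    by (simp add: poly_prod poly_monom)
  then have "y ^ m * (\<Prod>k<m. x / y - w ^ k) = x ^ m - y ^ m"
    using False by (simp add: power_divide field_simps)
  moreover have "y ^ m * (\<Prod>k<m. x / y - w ^ k) = (\<Prod>k<m. y * (x / y - w ^ k))"
    by (simp add: prod.distrib)
  moreover have "(\<Prod>k<m. y * (x / y - w ^ k)) = (\<Prod>k<m. x - y * w ^ k)"
    using False by (intro prod.cong) (simp_all add: field_simps)
  ultimately show ?thesis by simp
qed

text \<open>Dividing \<open>monom 1 m - 1\<close> by its linear factor with root 1 leaves a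
  geometric sum, whose value at 1 is \<open>m\<close>.\<close>

lemma prod_one_minus_primitive_root:
  assumes "primitive_root_of_unity w m"
  shows "(\<Prod>k\<in>{1..<m}. 1 - w ^ k) = of_nat m"
proof -
  have m: "m > 0" using assms by (simp add: primitive_root_of_unity_def)
  have split: "{..<m} = insert 0 {1..<m}" using m by auto
  have "[:-1, 1:] * (\<Prod>k\<in>{1..<m}. [:- (w ^ k), 1:]) = [:-1, 1:] * (\<Sum>k<m. monom 1 k)"
  proof -
    have "[:-1, 1:] * (\<Prod>k\<in>{1..<m}. [:- (w ^ k), 1:]) = monom 1 m - 1"
      using prod_primitive_root[OF assms] unfolding split by simp
    also have "\<dots> = [:-1, 1:] * (\<Sum>k<m. monom 1 k)"
    proof (rule poly_eq_poly_eq_iff[THEN iffD1], rule ext)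
      fix x :: complex
      show "poly (monom 1 m - 1) x = poly ([:-1, 1:] * (\<Sum>k<m. monom 1 k)) x"
        using power_diff_1_eq[of x m] by (simp add: poly_monom poly_sum algebra_simps)
    qed
    finally show ?thesis .
  qed
  then have "(\<Prod>k\<in>{1..<m}. [:- (w ^ k), 1:]) = (\<Sum>k<m. monom 1 k)"
    by (subst (asm) mult_cancel_left) simp
  from arg_cong[OF this, of "\<lambda>f. poly f 1"] show ?thesis
    by (simp add: poly_prod poly_sum poly_monom)
qed

text \<open>The product over all \<open>k\<close> is \<open>p * j\<close>. The multiples of
  \<open>p\<close> contribute the full product for \<open>w ^ p\<close>, which has order
  \<open>j\<close>, hence the factor \<open>j\<close>.\<close>

lemma prod_one_minus_primitive_root_not_dvd:
  assumes w: "primitive_root_of_unity w (p * j)" and p: "p > 0"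
  shows "(\<Prod>k | k \<in> {1..<p * j} \<and> \<not> p dvd k. 1 - w ^ k) = of_nat p"
    and "card {k. k \<in> {1..<p * j} \<and> \<not> p dvd k} = p * j - j"
proof -
  have j: "j > 0" using w by (simp add: primitive_root_of_unity_def)
  define A where "A = {k. k \<in> {1..<p * j} \<and> \<not> p dvd k}"
  define B where "B = (\<lambda>i. p * i) ` {1..<j}"
  have AB: "{1..<p * j} = A \<union> B" "A \<inter> B = {}"
    using p by (auto simp: A_def B_def elim!: dvdE)
  have fin: "finite A" "finite B" by (simp_all add: A_def B_def)
  have inj: "inj_on (\<lambda>i. p * i) {1..<j}" using p by (simp add: inj_on_def)
  have "(\<Prod>k\<in>B. 1 - w ^ k) = (\<Prod>i\<in>{1..<j}. 1 - (w ^ p) ^ i)"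
    unfolding B_def prod.reindex[OF inj] by (simp add: power_mult)
  also have "\<dots> = of_nat j"
    by (rule prod_one_minus_primitive_root[OF primitive_root_of_unity_power[OF w]])
  finally have "(\<Prod>k\<in>A. 1 - w ^ k) * of_nat j = of_nat (p * j)"
    using prod_one_minus_primitive_root[OF w] prod.union_disjoint[OF fin AB(2), of "\<lambda>k. 1 - w ^ k"]
    by (simp only: AB(1))
  then show "(\<Prod>k | k \<in> {1..<p * j} \<and> \<not> p dvd k. 1 - w ^ k) = of_nat p"
    using j by (simp add: A_def)
  have "card A + card B = p * j - 1"
    using card_Un_disjoint[OF fin AB(2)] by (simp flip: AB(1))
  moreover have "card B = j - 1" unfolding B_def card_image[OF inj] by simp
  ultimately show "card {k. k \<in> {1..<p * j} \<and> \<not> p dvd k} = p * j - j"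
    unfolding A_def[symmetric] using j p by simp
qed

text \<open>For \<open>k\<close> in \<open>A\<close>, the quotient of \<open>1 - (z ^ e) ^ k\<close>
  by \<open>1 - z ^ e\<close> is a nonzero geometric sum, so its norm is at least 1. The product of
  the numerators over \<open>A\<close> is \<open>p\<close> at every conjugate.\<close>

lemma norm_one_minus_primitive_root_le:
  assumes H: "finite H" "w \<in> H"
    and conj: "\<And>z f. z \<in> H \<Longrightarrow> ev f z = 0 \<longleftrightarrow> ev f w = 0"
    and int: "\<And>f. ev f w \<noteq> 0 \<Longrightarrow> norm (\<Prod>z\<in>H. ev f z) \<ge> 1"
    and prim: "\<And>z. z \<in> H \<Longrightarrow> primitive_root_of_unity (z ^ e) (p * j)" and p: "p > 0"
  shows "norm (\<Prod>z\<in>H. 1 - z ^ e) ^ (p * j - j) \<le> real p ^ card H"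
proof -
  define A where "A = {k. k \<in> {1..<p * j} \<and> \<not> p dvd k}"
  have A: "finite A" "card A = p * j - j" 
    using prod_one_minus_primitive_root_not_dvd(2)[OF prim[OF H(2)] p] by (simp_all add: A_def)
  have le: "norm (\<Prod>z\<in>H. 1 - z ^ e) \<le> norm (\<Prod>z\<in>H. 1 - (z ^ e) ^ k)" if k: "k \<in> A" for k
  proof -
    define f :: "int poly" where "f = (\<Sum>i<k. monom 1 (e * i))"
    have f: "1 - (z ^ e) ^ k = (1 - z ^ e) * ev f z" for z
    proof -
      have "ev f z = (\<Sum>i<k. (z ^ e) ^ i)"
      proof -
        have "ev (\<Sum>i\<in>I. monom 1 (e * i)) z = (\<Sum>i\<in>I. (z ^ e) ^ i)" if "finite I" for I
          using that by induction (simp_all add: power_mult)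
        then show ?thesis by (simp add: f_def)
      qed
      then show ?thesis using power_diff_1_eq[of "z ^ e" k] by (simp add: algebra_simps)
    qed
    have "1 - (w ^ e) ^ k \<noteq> 0"
      using prim[OF H(2)] k by (auto simp: primitive_root_of_unity_def A_def)
    then have "ev f w \<noteq> 0" unfolding f[of w] by simp
    then have "1 \<le> norm (\<Prod>z\<in>H. ev f z)" by (rule int)
    then have "norm (\<Prod>z\<in>H. 1 - z ^ e) * 1 \<le> norm (\<Prod>z\<in>H. 1 - z ^ e) * norm (\<Prod>z\<in>H. ev f z)"
      by (intro mult_left_mono) auto
    then show ?thesis unfolding f by (simp add: prod.distrib norm_mult)
  qed
  have "norm (\<Prod>z\<in>H. 1 - z ^ e) ^ (p * j - j) = (\<Prod>k\<in>A. norm (\<Prod>z\<in>H. 1 - z ^ e))"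
    by (simp add: A)
  also have "\<dots> \<le> (\<Prod>k\<in>A. norm (\<Prod>z\<in>H. 1 - (z ^ e) ^ k))"
    by (intro prod_mono) (use le in auto)
  also have "\<dots> = norm (\<Prod>z\<in>H. \<Prod>k\<in>A. 1 - (z ^ e) ^ k)"
    by (subst prod.swap) (simp add: prod_norm)
  also have "(\<Prod>z\<in>H. \<Prod>k\<in>A. 1 - (z ^ e) ^ k) = (\<Prod>z\<in>H. of_nat p)"
    using prod_one_minus_primitive_root_not_dvd(1)[OF prim p] by (intro prod.cong) (auto simp: A_def)
  finally show ?thesis by (simp add: norm_power)
qed

section \<open>Rotations of the conic with one coordinate fixed\<close>

fun rotation :: "'a::comm_ring_1 \<Rightarrow> 'a \<Rightarrow> 'a \<Rightarrow> nat \<Rightarrow> 'a" where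
  "rotation x a b 0 = a"
| "rotation x a b (Suc 0) = b"
| "rotation x a b (Suc (Suc k)) = x * rotation x a b (Suc k) - rotation x a b k"

text \<open>The move \<open>orb_1'\<close> sends \<open>(y, z)\<close> to
  \<open>(z, x * z - y)\<close>, which is one step of the recurrence.\<close>

lemma rotation_orb: "(x, rotation x a b k, rotation x a b (Suc k)) \<in> orb (x, a, b)"
  by (induction k) (auto intro: orb_base dest: orb.orb_1')

lemma rotation_hom:
  assumes "\<And>x y. h (x - y) = h x - h y" "\<And>x y. h (x * y) = h x * h y"
  shows "h (rotation x a b k) = rotation (h x) (h a) (h b) k"
  by (induction k rule: induct_nat_012) (simp_all add: assms)

text \<open>The entries are \<open>\<alpha> * u ^ k + \<beta> * inverse u ^ k\<close> with
  \<open>\<alpha>\<close> and \<open>\<beta>\<close> complex conjugate. Up to a factor of modulus 1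
  they are \<open>\<beta> + \<alpha> * (u\<^sup>2) ^ k\<close>, whose product over a full period is
  \<open>\<beta> ^ m - (- \<alpha>) ^ m\<close>, of modulus at most
  \<open>2 * norm \<alpha> ^ m\<close>.\<close>

lemma prod_rotation_le:
  fixes a b x :: real
  assumes u: "norm u = 1" "of_real x = u + inverse u" and prim: "primitive_root_of_unity (u\<^sup>2) m"
    and m: "m > 1"
  shows "(\<Prod>k<m. rotation x a b k)\<^sup>2 \<le> 4 * ((a\<^sup>2 + b\<^sup>2 - x * a * b) / (4 - x\<^sup>2)) ^ m"
proof -
  define v where "v = inverse u"
  have u0: "u \<noteq> 0" using u(1) by auto
  then have uv: "u * v = 1" by (simp add: v_def)
  have "u\<^sup>2 \<noteq> 1" using prim m unfolding primitive_root_of_unity_def by (metis power_one_right zero_less_one)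
  then have d0: "u - v \<noteq> 0" using uv u0 by (auto simp: power2_eq_square)
  have cnj_u: "cnj u = v"
    using u(1) complex_norm_square[of u] uv u0 by (metis mult_left_cancel of_real_1 power_one)
  have cnj_v: "cnj v = u" using cnj_u by (metis complex_cnj_cnj)
  \<comment> \<open>The solution of \<open>\<alpha> + \<beta> = a\<close> and
    \<open>\<alpha> * u + \<beta> * v = b\<close>, the two initial values.\<close>
  define \<alpha> where "\<alpha> = (of_real b - of_real a * v) / (u - v)"
  define \<beta> where "\<beta> = (of_real a * u - of_real b) / (u - v)"
  have \<alpha>\<beta>: "\<alpha> * (u - v) = of_real b - of_real a * v" "\<beta> * (u - v) = of_real a * u - of_real b"
    using d0 by (simp_all add: \<alpha>_def \<beta>_def)
  have cnj_\<alpha>: "cnj \<alpha> = \<beta>"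
    using d0 by (simp add: \<alpha>_def \<beta>_def cnj_u cnj_v field_simps)
  have y: "of_real (rotation x a b k) = \<alpha> * u ^ k + \<beta> * v ^ k" for k
  proof (induction k rule: induct_nat_012)
    case 0
    have "(\<alpha> + \<beta>) * (u - v) = of_real a * (u - v)"
      by (simp only: distrib_right \<alpha>\<beta>) (simp add: algebra_simps)
    then show ?case using d0 by simp
  next
    case 1
    have "(\<alpha> * u + \<beta> * v) * (u - v) = (\<alpha> * (u - v)) * u + (\<beta> * (u - v)) * v"
      by (simp add: algebra_simps)
    also have "\<dots> = of_real b * (u - v)" by (simp only: \<alpha>\<beta>) (simp add: algebra_simps)
    finally show ?case using d0 by simp
  next
    case (ge2 k)
    have uvt: "u * (v * t) = t" for t using uv by (simp flip: mult.assoc)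
    show ?case using ge2 u(2) by (simp add: v_def[symmetric] algebra_simps uvt)
  qed
  have norm_\<beta>: "norm \<beta> = norm \<alpha>" using cnj_\<alpha> by (metis complex_mod_cnj)
  have norm_\<alpha>: "(norm \<alpha>)\<^sup>2 = (a\<^sup>2 + b\<^sup>2 - x * a * b) / (4 - x\<^sup>2)"
  proof -
    have x: "complex_of_real x = u + v" using u(2) by (simp add: v_def)
    have "(u - v)\<^sup>2 = (u + v)\<^sup>2 - 4 * (u * v)"
      by (simp add: power2_eq_square algebra_simps)
    then have D: "(u - v) * (u - v) = of_real (x\<^sup>2 - 4)" using uv by (simp add: x power2_eq_square)
    have "(of_real b - of_real a * v) * (of_real a * u - of_real b) =
        of_real a * of_real b * (u + v) - (of_real b)\<^sup>2 - (of_real a)\<^sup>2 * (u * v)"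
      by (simp add: power2_eq_square algebra_simps)
    then have N: "(of_real b - of_real a * v) * (of_real a * u - of_real b) =
        complex_of_real (x * a * b - b\<^sup>2 - a\<^sup>2)"
      using uv by (simp add: x[symmetric])
    have "complex_of_real ((norm \<alpha>)\<^sup>2) = \<alpha> * \<beta>"
      using complex_norm_square[of \<alpha>] by (simp add: cnj_\<alpha>)
    also have "\<dots> = of_real ((x * a * b - b\<^sup>2 - a\<^sup>2) / (x\<^sup>2 - 4))"
      by (simp only: \<alpha>_def \<beta>_def times_divide_times_eq N D of_real_divide)
    also have "(x * a * b - b\<^sup>2 - a\<^sup>2) / (x\<^sup>2 - 4) = (a\<^sup>2 + b\<^sup>2 - x * a * b) / (4 - x\<^sup>2)"
      using minus_divide_divide[of "a\<^sup>2 + b\<^sup>2 - x * a * b" "4 - x\<^sup>2"] by (simp add: algebra_simps)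
    finally have "complex_of_real ((norm \<alpha>)\<^sup>2) = of_real ((a\<^sup>2 + b\<^sup>2 - x * a * b) / (4 - x\<^sup>2))" .
    then show ?thesis by (simp only: of_real_eq_iff)
  qed
  have term_norm: "\<bar>rotation x a b k\<bar> = norm (\<beta> - (- \<alpha>) * (u\<^sup>2) ^ k)" for k
  proof -
    have "\<bar>rotation x a b k\<bar> = norm (u ^ k * (\<alpha> * u ^ k + \<beta> * v ^ k))"
      using u(1) arg_cong[OF y[of k], of norm] by (simp add: norm_mult norm_power)
    also have "u ^ k * (\<alpha> * u ^ k + \<beta> * v ^ k) = \<alpha> * (u\<^sup>2) ^ k + \<beta> * (u * v) ^ k"
      by (simp add: algebra_simps power2_eq_square power_mult_distrib)
    finally show ?thesis using uv by (simp add: add.commute)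
  qed
  have "\<bar>\<Prod>k<m. rotation x a b k\<bar> = norm (\<Prod>k<m. \<beta> - (- \<alpha>) * (u\<^sup>2) ^ k)"
    by (simp only: abs_prod term_norm prod_norm)
  also have "\<dots> = norm (\<beta> ^ m - (- \<alpha>) ^ m)"
    by (simp only: prod_primitive_root_homogeneous[OF prim])
  also have "\<dots> \<le> norm \<alpha> ^ m + norm \<alpha> ^ m"
    using norm_triangle_ineq4[of "\<beta> ^ m" "(- \<alpha>) ^ m"] by (simp add: norm_power norm_\<beta>)
  finally have "\<bar>\<Prod>k<m. rotation x a b k\<bar>\<^sup>2 \<le> (2 * norm \<alpha> ^ m)\<^sup>2"
    by (intro power_mono) auto
  also have "\<dots> = 4 * ((norm \<alpha>)\<^sup>2) ^ m"
    by (simp add: power_mult_distrib flip: power_mult) (simp add: mult.commute)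
  finally show ?thesis by (simp only: norm_\<alpha> power2_abs)
qed

section \<open>Bounds on the order of a coordinate\<close>

lemma root_of_unity_eq_power:
  assumes "N > 0" "z ^ N = 1"
  obtains a where "z = cis (2 * pi / real N) ^ a"
proof -
  have "z \<in> (\<lambda>k. cis (2 * pi * real k / real N)) ` {..<N}"
    using bij_betw_roots_unity[of N] assms by (auto simp: bij_betw_def)
  then obtain k where "z = cis (2 * pi * real k / real N)" by blast
  then have "z = cis (2 * pi / real N) ^ k" by (simp add: DeMoivre field_simps)
  then show thesis by (rule that)
qed

lemma primitive_root_of_unity_cis:
  assumes "N > 0" shows "primitive_root_of_unity (cis (2 * pi / real N)) N"
  unfolding primitive_root_of_unity_def
proof (intro conjI allI impI)
  let ?w = "cis (2 * pi / real N)"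
  show "?w ^ N = 1" using assms by (simp add: DeMoivre)
  have inj: "inj_on (\<lambda>k. cis (2 * pi * real k / real N)) {..<N}"
    using bij_betw_roots_unity[OF assms] by (simp add: bij_betw_def)
  fix d assume d: "0 < d \<and> d < N"
  show "?w ^ d \<noteq> 1"
  proof
    assume "?w ^ d = 1"
    then have "cis (2 * pi * real d / real N) = cis (2 * pi * real 0 / real N)"
      by (simp add: DeMoivre field_simps)
    with inj_onD[OF inj this] d show False by simp
  qed
qed (use assms in simp)

lemma root_of_unity_inverse:
  fixes z :: complex
  assumes "N > 0" "z ^ N = 1" shows "inverse z = z ^ (N - 1)"
  using assms by (metis inverse_unique power_eq_if not_gr_zero)

text \<open>One root of unity \<open>w\<close> generates those behind all three coordinates, so each
  conjugate of \<open>w\<close> gives a real triple with bounded orbit. Collected here is what the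
  order bounds compare: the norms of \<open>4 - markov\<close> and of nonzero rotation entries are
  at least 1, that of \<open>4 - x1\<^sup>2\<close> is small.\<close>

lemma conjugate_triples:
  fixes x1 x2 x3 z :: complex
  assumes co: "cos_orbit (x1, x2, x3)" and ne4: "markov (x1, x2, x3) \<noteq> 4"
    and prim: "primitive_root_of_unity (z\<^sup>2) (p * j)" and x1: "x1 = z + inverse z" and p: "p > 0"
  obtains H :: "complex set" and u :: "complex \<Rightarrow> complex" and a b c :: "complex \<Rightarrow> real"
  where "finite H" "H \<noteq> {}"
    "\<And>r. r \<in> H \<Longrightarrow> norm (u r) = 1"
    "\<And>r. r \<in> H \<Longrightarrow> of_real (a r) = u r + inverse (u r)"
    "\<And>r. r \<in> H \<Longrightarrow> primitive_root_of_unity ((u r)\<^sup>2) (p * j)"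
    "\<And>r. r \<in> H \<Longrightarrow> markov (a r, b r, c r) < 4"
    "1 \<le> (\<Prod>r\<in>H. 4 - markov (a r, b r, c r))"
    "(\<Prod>r\<in>H. 4 - (a r)\<^sup>2) ^ (p * j - j) \<le> real p ^ (2 * card H)"
    "\<And>k r. rotation x1 x2 x3 k = 0 \<Longrightarrow> r \<in> H \<Longrightarrow> rotation (a r) (b r) (c r) k = 0"
    "\<And>k. rotation x1 x2 x3 k \<noteq> 0 \<Longrightarrow> 1 \<le> \<bar>\<Prod>r\<in>H. rotation (a r) (b r) (c r) k\<bar>"
proof -
  have "x2 \<in> two_cos" "x3 \<in> two_cos" using cos_orbitD[OF co orb_base] by blast+
  then obtain z2 n2 z3 n3 where z2: "n2 > 0" "z2 ^ n2 = 1" "x2 = z2 + inverse z2"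
    and z3: "n3 > 0" "z3 ^ n3 = 1" "x3 = z3 + inverse z3"
    by (auto simp: two_cos_def)
  define N where "N = 2 * (p * j) * n2 * n3"
  have m: "p * j > 0" "z ^ (2 * (p * j)) = 1" 
    using prim by (simp_all add: primitive_root_of_unity_def power_mult)
  have N: "N > 0" using m z2 z3 by (simp add: N_def)
  have zN: "z ^ N = 1" "z2 ^ N = 1" "z3 ^ N = 1"
  proof -
    have one: "y ^ N = 1" if "y ^ n = 1" "n dvd N" for y :: complex and n
      using that by (metis dvd_def power_mult power_one)
    show "z ^ N = 1" "z2 ^ N = 1" "z3 ^ N = 1"
      by (rule one, fact m(2) z2(2) z3(2), simp add: N_def)+
  qed
  define w where "w = cis (2 * pi / real N)"
  obtain a1 a2 a3 where za: "z = w ^ a1" "z2 = w ^ a2" "z3 = w ^ a3"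
    unfolding w_def by (metis root_of_unity_eq_power[OF N] zN)
  have w: "primitive_root_of_unity w N" unfolding w_def by (rule primitive_root_of_unity_cis[OF N])
  obtain H where H: "finite H" "w \<in> H"
    and conj: "\<And>z f. z \<in> H \<Longrightarrow> ev f z = 0 \<longleftrightarrow> ev f w = 0"
    and int: "\<And>f. ev f w \<noteq> 0 \<Longrightarrow> norm (\<Prod>z\<in>H. ev f z) \<ge> 1"
    using conjugates_of_root_of_unity[of N w] w unfolding primitive_root_of_unity_def by metis
  have HN: "r ^ N = 1" if "r \<in> H" for r
    using conj[OF that, of "monom 1 N - 1"] w by (simp add: primitive_root_of_unity_def)
  \<comment> \<open>If \<open>r ^ N = 1\<close>, then \<open>r ^ (i * (N - 1))\<close> is the
    inverse of \<open>r ^ i\<close>; this avoids negative powers.\<close>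
  define f :: "nat \<Rightarrow> int poly" where "f = (\<lambda>i. monom 1 i + monom 1 (i * (N - 1)))"
  have f: "ev (f i) r = r ^ i + inverse (r ^ i)" if "r \<in> H" for i r
  proof -
    have "(r ^ i) ^ N = 1" using HN[OF that] by (metis mult.commute power_mult power_one)
    then show ?thesis using root_of_unity_inverse[OF N] by (simp add: f_def power_mult)
  qed
  define F where "F = (f a1, f a2, f a3)"
  have Fw: "map3 (\<lambda>g. ev g w) F = (x1, x2, x3)"
    using f[OF H(2)] by (simp add: F_def x1 z2(3) z3(3) za)
  define a b c where "a = (\<lambda>r. Re (ev (f a1) r))" and "b = (\<lambda>r. Re (ev (f a2) r))"
    and "c = (\<lambda>r. Re (ev (f a3) r))"
  have real: "ev (f a1) r = of_real (a r)" "ev (f a2) r = of_real (b r)" "ev (f a3) r = of_real (c r)"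
    "markov (a r, b r, c r) \<le> 4" if r: "r \<in> H" for r
  proof -
    have "cos_orbit (map3 (\<lambda>g. ev g r) F)"
      by (rule cos_orbit_conjugate[of w]) (use conj[OF r] co Fw in auto)
    then obtain s where s: "map3 (\<lambda>g. ev g r) F = map3 of_real s" "markov s \<le> 4"
      by (rule cos_orbit_real)
    obtain a' b' c' where s': "s = (a', b', c')" by (cases s)
    show "ev (f a1) r = of_real (a r)" "ev (f a2) r = of_real (b r)" "ev (f a3) r = of_real (c r)"
      using s(1) by (simp_all add: F_def a_def b_def c_def s')
    show "markov (a r, b r, c r) \<le> 4"
      using s by (simp add: F_def a_def b_def c_def s')
  qed
  have ev_markov: "ev (4 - markov F) r = of_real (4 - markov (a r, b r, c r))" if "r \<in> H" for r
    using real[OF that] by (simp add: F_def)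
  have markov_w: "ev (4 - markov F) w \<noteq> 0"
  proof -
    have "ev (markov F) w = markov (map3 (\<lambda>g. ev g w) F)" by (simp add: F_def)
    then show ?thesis using ne4 by (simp add: Fw del: markov.simps)
  qed
  have rot: "ev (rotation (f a1) (f a2) (f a3) k) r = of_real (rotation (a r) (b r) (c r) k)"
    if "r \<in> H" for k r
    using rotation_hom[of "\<lambda>g. ev g r" "f a1" "f a2" "f a3" k]
      rotation_hom[of complex_of_real "a r" "b r" "c r" k] real[OF that] by simp
  have rot_w: "ev (rotation (f a1) (f a2) (f a3) k) w = rotation x1 x2 x3 k" for k
    using rotation_hom[of "\<lambda>g. ev g w" "f a1" "f a2" "f a3" k] Fw by (simp add: F_def)
  define u where "u = (\<lambda>r::complex. r ^ a1)"
  have norm_u: "norm (u r) = 1" if "r \<in> H" for r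
  proof -
    have "norm r ^ N = 1 ^ N" using HN[OF that] by (metis norm_one norm_power power_one)
    then have "norm r = 1" using N power_eq_imp_eq_base[of "norm r" N 1] by simp
    then show ?thesis by (simp add: u_def norm_power)
  qed
  have prim_u: "primitive_root_of_unity ((u r)\<^sup>2) (p * j)" if "r \<in> H" for r
  proof -
    have "((u r)\<^sup>2) ^ d = 1 \<longleftrightarrow> (z\<^sup>2) ^ d = 1" for d
      using conj[OF that, of "monom 1 (a1 * 2 * d) - 1"] by (simp add: u_def za power_mult)
    then show ?thesis using prim by (simp add: primitive_root_of_unity_def)
  qed
  show thesis
  proof (rule that[of H u a b c])
    show "finite H" "H \<noteq> {}" using H by auto
  next
    fix r assume r: "r \<in> H"
    show "norm (u r) = 1" "primitive_root_of_unity ((u r)\<^sup>2) (p * j)" 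
      using norm_u prim_u r by auto
    show "of_real (a r) = u r + inverse (u r)" using f[OF r, of a1] real(1)[OF r] by (simp add: u_def)
    \<comment> \<open>The value 4 is excluded at every conjugate: if \<open>4 - markov F\<close>
      vanished at \<open>r\<close>, it would vanish at \<open>w\<close>.\<close>
    have "ev (4 - markov F) r \<noteq> 0" using conj[OF r] markov_w by blast
    then have "4 - markov (a r, b r, c r) \<noteq> 0" unfolding ev_markov[OF r] by (metis of_real_0)
    with real(4)[OF r] show "markov (a r, b r, c r) < 4" by linarith
  next
    have "1 \<le> norm (\<Prod>r\<in>H. ev (4 - markov F) r)" by (rule int[OF markov_w])
    also have "\<dots> = (\<Prod>r\<in>H. 4 - markov (a r, b r, c r))"
      unfolding prod_norm[symmetric] using ev_markov real(4)
      by (intro prod.cong HOL.refl) (simp del: markov.simps ev_diff of_real_diff)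
    finally show "1 \<le> (\<Prod>r\<in>H. 4 - markov (a r, b r, c r))" .
  next
    \<comment> \<open>As \<open>u r\<close> has modulus 1, the product of
      \<open>1 - (u r)\<^sup>2\<close> and its complex conjugate expands to
      \<open>4 - (a r)\<^sup>2\<close>.\<close>
    have sq: "4 - (a r)\<^sup>2 = (norm (1 - r ^ (a1 * 2)))\<^sup>2" if r: "r \<in> H" for r
    proof -
      have uu: "u r * cnj (u r) = 1" using norm_u[OF r] complex_norm_square[of "u r"] by simp
      then have inv: "inverse (u r) = cnj (u r)" by (rule inverse_unique)
      have "complex_of_real (4 - (a r)\<^sup>2) = 4 - (u r + cnj (u r))\<^sup>2"
        using f[OF r, of a1] real(1)[OF r] by (simp add: u_def[symmetric] inv[symmetric]) (simp add: u_def)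
      also have "\<dots> = 2 * (u r * cnj (u r)) - (u r)\<^sup>2 - (cnj (u r))\<^sup>2"
        using uu by (simp add: power2_eq_square algebra_simps)
      also have "\<dots> = (1 - (u r)\<^sup>2) * cnj (1 - (u r)\<^sup>2)"
      proof -
        have "(u r)\<^sup>2 * (cnj (u r))\<^sup>2 = 1" using uu by (metis power_mult_distrib power_one)
        then show ?thesis using uu by (simp add: algebra_simps)
      qed
      also have "\<dots> = of_real ((norm (1 - (u r)\<^sup>2))\<^sup>2)" by (rule complex_norm_square[symmetric])
      finally show ?thesis unfolding of_real_eq_iff by (simp add: u_def power_mult)
    qed
    have "norm (\<Prod>r\<in>H. 1 - r ^ (a1 * 2)) ^ (p * j - j) \<le> real p ^ card H"
      by (rule norm_one_minus_primitive_root_le[OF H conj int])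
        (use prim_u p in \<open>simp_all add: u_def power_mult\<close>)
    then have "(norm (\<Prod>r\<in>H. 1 - r ^ (a1 * 2)) ^ (p * j - j))\<^sup>2 \<le> (real p ^ card H)\<^sup>2"
      by (intro power_mono) auto
    moreover have "(\<Prod>r\<in>H. 4 - (a r)\<^sup>2) = (norm (\<Prod>r\<in>H. 1 - r ^ (a1 * 2)))\<^sup>2"
      by (simp add: sq prod_norm[symmetric] prod_power_distrib)
    ultimately show "(\<Prod>r\<in>H. 4 - (a r)\<^sup>2) ^ (p * j - j) \<le> real p ^ (2 * card H)"
      by (simp add: mult.commute flip: power_mult)
  next
    fix k r assume "rotation x1 x2 x3 k = 0" and r: "r \<in> H"
    then have "ev (rotation (f a1) (f a2) (f a3) k) r = 0" using conj[OF r] rot_w by simp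
    then show "rotation (a r) (b r) (c r) k = 0" using rot[OF r] by simp
  next
    fix k assume "rotation x1 x2 x3 k \<noteq> 0"
    then have "1 \<le> norm (\<Prod>r\<in>H. ev (rotation (f a1) (f a2) (f a3) k) r)"
      by (intro int) (simp add: rot_w)
    also have "\<dots> = \<bar>\<Prod>r\<in>H. rotation (a r) (b r) (c r) k\<bar>"
      by (simp add: rot prod_norm[symmetric] abs_prod)
    finally show "1 \<le> \<bar>\<Prod>r\<in>H. rotation (a r) (b r) (c r) k\<bar>" .
  qed
qed

lemma four_minus_square_pos:
  fixes a :: real
  assumes "norm u = 1" "of_real a = u + inverse u" "primitive_root_of_unity (u\<^sup>2) m" "m > 1"
  shows "a\<^sup>2 < 4"
proof -
  have uu: "u * cnj u = 1" using assms(1) complex_norm_square[of u] by simp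
  then have inv: "inverse u = cnj u" by (rule inverse_unique)
  have a: "a = 2 * Re u" using assms(2) by (simp add: inv complex_eq_iff)
  have re: "(Re u)\<^sup>2 + (Im u)\<^sup>2 = 1" using assms(1) cmod_power2[of u] by simp
  have "Im u \<noteq> 0"
  proof
    assume "Im u = 0"
    then have "u = cnj u" by (simp add: complex_eq_iff)
    then have "u\<^sup>2 = 1" using uu by (simp add: power2_eq_square)
    then show False using assms(3,4) unfolding primitive_root_of_unity_def
      by (metis power_one_right zero_less_one)
  qed
  then have "(Im u)\<^sup>2 > 0" by simp
  with re have "(Re u)\<^sup>2 < 1" by linarith
  then show ?thesis by (simp add: a power_mult_distrib)
qed

lemma le_of_power_le:
  fixes a b :: real
  assumes "a ^ n \<le> b ^ n" "0 \<le> b" "0 < n" shows "a \<le> b"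
  using assms power_strict_mono[of b a n] by (meson not_less)

lemma conic_form_nonneg:
  fixes a b c :: real
  assumes "a\<^sup>2 \<le> 4" shows "0 \<le> b\<^sup>2 + c\<^sup>2 - a * b * c"
proof -
  have "b\<^sup>2 + c\<^sup>2 - a * b * c = (b - a * c / 2)\<^sup>2 + c\<^sup>2 * (4 - a\<^sup>2) / 4"
    by (simp add: power2_eq_square field_simps)
  also have "\<dots> \<ge> 0" using assms by simp
  finally show ?thesis .
qed

text \<open>Both \<open>T = (4 - markov) / (4 - x1\<^sup>2)\<close> and \<open>1 - T = x3\<^sup>2 / (4 - x1\<^sup>2)\<close> lie in \<open>(0, 1)\<close> at
  every conjugate, so their product is at most \<open>1 / 4\<close> there, while the norms of the numerators are
  at least 1.\<close>

lemma order_bound_zero: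
  assumes co: "cos_orbit (x1, 0, x3)" and ne4: "markov (x1, 0, x3) \<noteq> 4" and x3: "x3 \<noteq> 0"
    and prim: "primitive_root_of_unity (z\<^sup>2) (p * j)" and x1: "x1 = z + inverse z"
    and p: "p > 0" "p * j > 1"
  shows "2 ^ (p * j - j) \<le> p\<^sup>2"
proof -
  obtain H :: "complex set" and u and a b c :: "complex \<Rightarrow> real"
    where H: "finite H" "H \<noteq> {}"
    and u: "\<And>r. r \<in> H \<Longrightarrow> norm (u r) = 1"
    "\<And>r. r \<in> H \<Longrightarrow> of_real (a r) = u r + inverse (u r)"
    "\<And>r. r \<in> H \<Longrightarrow> primitive_root_of_unity ((u r)\<^sup>2) (p * j)"
    and M4: "\<And>r. r \<in> H \<Longrightarrow> markov (a r, b r, c r) < 4"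
    and M: "1 \<le> (\<Prod>r\<in>H. 4 - markov (a r, b r, c r))"
    and D: "(\<Prod>r\<in>H. 4 - (a r)\<^sup>2) ^ (p * j - j) \<le> real p ^ (2 * card H)"
    and rot: "\<And>k r. rotation x1 0 x3 k = 0 \<Longrightarrow> r \<in> H \<Longrightarrow> rotation (a r) (b r) (c r) k = 0"
    "\<And>k. rotation x1 0 x3 k \<noteq> 0 \<Longrightarrow> 1 \<le> \<bar>\<Prod>r\<in>H. rotation (a r) (b r) (c r) k\<bar>"
    by (rule conjugate_triples[OF co ne4 prim x1 p(1)]) blast
  \<comment> \<open>Index 0 of the rotation is the second coordinate, which stays zero at all
    conjugates; index 1 is the third, whose norm is at least 1.\<close>
  have b: "b r = 0" if "r \<in> H" for r using rot(1)[of 0 r] that by simp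
  have c: "1 \<le> \<bar>\<Prod>r\<in>H. c r\<bar>" using rot(2)[of 1] x3 by simp
  have a: "(a r)\<^sup>2 < 4" if "r \<in> H" for r
    using four_minus_square_pos[OF u(1)[OF that] u(2)[OF that] u(3)[OF that] p(2)] .
  \<comment> \<open>Arithmetic-geometric mean inequality: \<open>4 - markov\<close> and
    \<open>(c r)\<^sup>2\<close> add up to \<open>4 - (a r)\<^sup>2\<close>.\<close>
  have pt: "4 * (4 - markov (a r, b r, c r)) * (c r)\<^sup>2 \<le> (4 - (a r)\<^sup>2)\<^sup>2" if "r \<in> H" for r
  proof -
    have "0 \<le> (4 - (a r)\<^sup>2 - 2 * (c r)\<^sup>2)\<^sup>2" by simp
    then show ?thesis using b[OF that] by (simp add: power2_eq_square algebra_simps)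
  qed
  define P where "P = (\<Prod>r\<in>H. 4 - (a r)\<^sup>2)"
  have P0: "P > 0" unfolding P_def by (rule prod_pos) (use a in auto)
  have "(4 :: real) ^ card H = 4 ^ card H * 1 * 1\<^sup>2" by simp
  also have "\<dots> \<le> 4 ^ card H * (\<Prod>r\<in>H. 4 - markov (a r, b r, c r)) * \<bar>\<Prod>r\<in>H. c r\<bar>\<^sup>2"
    using M c by (intro mult_mono power_mono) auto
  also have "\<dots> = (\<Prod>r\<in>H. 4 * (4 - markov (a r, b r, c r)) * (c r)\<^sup>2)"
    by (simp only: prod.distrib prod_power_distrib prod_constant power2_abs)
  also have "\<dots> \<le> (\<Prod>r\<in>H. (4 - (a r)\<^sup>2)\<^sup>2)"
    using pt M4 by (intro prod_mono conjI mult_nonneg_nonneg) (auto simp: less_imp_le simp del: markov.simps)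
  also have "\<dots> = P\<^sup>2" by (simp add: P_def prod_power_distrib)
  finally have "4 ^ card H \<le> P\<^sup>2" .
  moreover have "(4 :: real) ^ card H = (2 ^ card H)\<^sup>2"
  proof -
    have four: "(4 :: real) = 2\<^sup>2" by simp
    show ?thesis by (simp only: four power_mult[symmetric] mult_ac)
  qed
  ultimately have "(2 ^ card H)\<^sup>2 \<le> P\<^sup>2" by (simp only:)
  then have "2 ^ card H \<le> P" by (rule power2_le_imp_le) (use P0 in simp)
  then have "(2 ^ card H) ^ (p * j - j) \<le> P ^ (p * j - j)" by (rule power_mono) simp
  also have "\<dots> \<le> real p ^ (2 * card H)" using D by (simp add: P_def)
  finally have "(2 ^ (p * j - j)) ^ card H \<le> ((real p)\<^sup>2) ^ card H"
    by (simp only: power_mult[symmetric] mult_ac)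
  then have "2 ^ (p * j - j) \<le> (real p)\<^sup>2"
    by (rule le_of_power_le) (use H in \<open>simp_all add: card_gt_0_iff\<close>)
  then have "real (2 ^ (p * j - j)) \<le> real (p\<^sup>2)" by (simp only: of_nat_power of_nat_numeral)
  then show ?thesis by (simp only: of_nat_le_iff)
qed

text \<open>All \<open>m = p * j\<close> rotation entries have norm at least 1. At a conjugate put
  \<open>d = 4 - a\<^sup>2\<close> and \<open>e = b\<^sup>2 + c\<^sup>2 - a * b * c\<close>, so that
  \<open>4 - markov = d - e\<close>. The squared product of the entries is at most
  \<open>4 * (e / d) ^ m\<close>, and \<open>4 * (d - e) * e \<le> d\<^sup>2\<close>. Multiplying
  over the conjugates bounds the norm of \<open>d\<close> from below, against its upper bound
  \<open>D\<close>.\<close>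

lemma order_bound_nonzero:
  assumes co: "cos_orbit (x1, x2, x3)" and ne4: "markov (x1, x2, x3) \<noteq> 4"
    and nz: "\<And>k. rotation x1 x2 x3 k \<noteq> 0"
    and prim: "primitive_root_of_unity (z\<^sup>2) (p * j)" and x1: "x1 = z + inverse z"
    and p: "p > 0" "p * j > 1"
  shows "2 ^ ((p * j - 1) * (p * j - j)) \<le> p ^ (p * j)"
proof -
  define m where "m = p * j"
  obtain H :: "complex set" and u and a b c :: "complex \<Rightarrow> real"
    where H: "finite H" "H \<noteq> {}"
    and u: "\<And>r. r \<in> H \<Longrightarrow> norm (u r) = 1"
    "\<And>r. r \<in> H \<Longrightarrow> of_real (a r) = u r + inverse (u r)"
    "\<And>r. r \<in> H \<Longrightarrow> primitive_root_of_unity ((u r)\<^sup>2) (p * j)"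
    and M4: "\<And>r. r \<in> H \<Longrightarrow> markov (a r, b r, c r) < 4"
    and M: "1 \<le> (\<Prod>r\<in>H. 4 - markov (a r, b r, c r))"
    and D: "(\<Prod>r\<in>H. 4 - (a r)\<^sup>2) ^ (p * j - j) \<le> real p ^ (2 * card H)"
    and rot: "\<And>k. rotation x1 x2 x3 k \<noteq> 0 \<Longrightarrow> 1 \<le> \<bar>\<Prod>r\<in>H. rotation (a r) (b r) (c r) k\<bar>"
    by (rule conjugate_triples[OF co ne4 prim x1 p(1)]) blast
  have a: "(a r)\<^sup>2 < 4" if "r \<in> H" for r
    using four_minus_square_pos[OF u(1)[OF that] u(2)[OF that] u(3)[OF that] p(2)] .
  define Y where "Y = (\<lambda>r. \<Prod>k<m. rotation (a r) (b r) (c r) k)"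
  define M' where "M' = (\<lambda>r. markov (a r, b r, c r))"
  have pt: "4 ^ m * (4 - M' r) ^ m * (Y r)\<^sup>2 \<le> 4 * (4 - (a r)\<^sup>2) ^ m" if r: "r \<in> H" for r
  proof -
    define d where "d = 4 - (a r)\<^sup>2"
    define e where "e = (b r)\<^sup>2 + (c r)\<^sup>2 - a r * b r * c r"
    have d: "d > 0" using a[OF r] by (simp add: d_def)
    have e: "e \<ge> 0" unfolding e_def by (rule conic_form_nonneg) (use a[OF r] in simp)
    have Me: "4 - M' r = d - e" by (simp add: M'_def d_def e_def)
    have Mpos: "4 - M' r \<ge> 0" using M4[OF r] by (simp add: M'_def)
    have "(Y r)\<^sup>2 \<le> 4 * (e / d) ^ m"
      unfolding Y_def e_def d_def m_def by (rule prod_rotation_le[OF u(1-3)[OF r] p(2)])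
    then have "4 ^ m * (4 - M' r) ^ m * (Y r)\<^sup>2 \<le> 4 ^ m * (4 - M' r) ^ m * (4 * (e / d) ^ m)"
      using Mpos by (intro mult_left_mono) auto
    also have "\<dots> = 4 * (4 * (d - e) * e / d) ^ m"
      by (simp only: Me power_mult_distrib power_divide times_divide_eq_right times_divide_eq_left mult_ac)
    also have "\<dots> \<le> 4 * d ^ m"
    proof (intro mult_left_mono power_mono)
      have "0 \<le> (d - 2 * e)\<^sup>2" by simp
      then show "4 * (d - e) * e / d \<le> d"
        using d by (simp add: divide_le_eq power2_eq_square algebra_simps)
      show "0 \<le> 4 * (d - e) * e / d" using d e Mpos by (simp add: Me)
    qed simp
    finally show ?thesis by (simp add: d_def)
  qed
  define P where "P = (\<Prod>r\<in>H. 4 - (a r)\<^sup>2)"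
  have P0: "P > 0" unfolding P_def by (rule prod_pos) (use a in auto)
  have Y: "1 \<le> \<bar>\<Prod>r\<in>H. Y r\<bar>"
  proof -
    have "(\<Prod>r\<in>H. Y r) = (\<Prod>k<m. \<Prod>r\<in>H. rotation (a r) (b r) (c r) k)"
      unfolding Y_def by (rule prod.swap)
    then have "\<bar>\<Prod>r\<in>H. Y r\<bar> = (\<Prod>k<m. \<bar>\<Prod>r\<in>H. rotation (a r) (b r) (c r) k\<bar>)"
      by (simp add: abs_prod)
    also have "\<dots> \<ge> 1" by (rule prod_ge_1) (use rot nz in auto)
    finally show ?thesis .
  qed
  have "(4 :: real) ^ (m * card H) = (4 ^ m) ^ card H * 1 ^ m * 1\<^sup>2" by (simp add: power_mult)
  also have "\<dots> \<le> (4 ^ m) ^ card H * (\<Prod>r\<in>H. 4 - M' r) ^ m * \<bar>\<Prod>r\<in>H. Y r\<bar>\<^sup>2"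
    using M Y by (intro mult_mono power_mono) (auto simp: M'_def simp del: markov.simps)
  also have "\<dots> = (\<Prod>r\<in>H. 4 ^ m * (4 - M' r) ^ m * (Y r)\<^sup>2)"
    by (simp only: prod.distrib prod_power_distrib prod_constant power2_abs)
  also have "\<dots> \<le> (\<Prod>r\<in>H. 4 * (4 - (a r)\<^sup>2) ^ m)"
    using pt M4 by (intro prod_mono conjI mult_nonneg_nonneg)
      (auto simp: M'_def less_imp_le simp del: markov.simps)
  also have "\<dots> = 4 ^ card H * P ^ m" by (simp only: P_def prod.distrib prod_power_distrib prod_constant)
  finally have "4 ^ (m * card H) \<le> 4 ^ card H * P ^ m" .
  \<comment> \<open>The factor 4 in the rotation bound costs one of the \<open>m\<close> powers of 4
    per conjugate, hence the exponent \<open>m - 1\<close>.\<close>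
  moreover have "m * card H = card H + (m - 1) * card H" 
    using p(2) by (simp add: m_def[symmetric] diff_mult_distrib)
  ultimately have "4 ^ ((m - 1) * card H) \<le> P ^ m" by (simp add: power_add)
  then have "(4 ^ ((m - 1) * card H)) ^ (p * j - j) \<le> (P ^ m) ^ (p * j - j)" by (rule power_mono) simp
  also have "\<dots> = (P ^ (p * j - j)) ^ m" by (simp only: power_mult[symmetric] mult_ac)
  also have "\<dots> \<le> (real p ^ (2 * card H)) ^ m" using D P0 by (intro power_mono) (auto simp: P_def)
  also have "(real p ^ (2 * card H)) ^ m = (real p ^ m) ^ (2 * card H)"
    by (simp only: power_mult[symmetric] mult_ac)
  also have "(4 ^ ((m - 1) * card H)) ^ (p * j - j) = (2 ^ ((m - 1) * (p * j - j)) :: real) ^ (2 * card H)"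
  proof -
    have four: "(4 :: real) = 2\<^sup>2" by simp
    show ?thesis by (simp only: four power_mult[symmetric] mult_ac)
  qed
  finally have "(2 ^ ((m - 1) * (p * j - j))) ^ (2 * card H) \<le> (real p ^ m) ^ (2 * card H)" .
  then have "2 ^ ((m - 1) * (p * j - j)) \<le> real p ^ m"
    by (rule le_of_power_le) (use H in \<open>simp_all add: card_gt_0_iff\<close>)
  then have "real (2 ^ ((m - 1) * (p * j - j))) \<le> real (p ^ m)" by (simp only: of_nat_power of_nat_numeral)
  then show ?thesis unfolding m_def by (simp only: of_nat_le_iff)
qed

section \<open>Every orbit contains a zero\<close>

text \<open>The exponent is \<open>(p - 1) * j\<close>. From \<open>p = 7\<close> on the exponential
  exceeds \<open>p\<^sup>2\<close>; for the primes 2, 3 and 5 the inequality bounds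
  \<open>j\<close>.\<close>

lemma order_bound_zero_cases:
  fixes p j :: nat
  assumes p: "prime p" and j: "j > 0" and le: "2 ^ (p * j - j) \<le> p\<^sup>2"
  shows "p * j \<in> {2, 3, 4, 5}"
proof -
  have p2: "p \<ge> 2" using p by (rule prime_ge_2_nat)
  have e: "p * j - j = (p - 1) * j" by (simp add: diff_mult_distrib)
  have j1: "2 ^ (p - 1) \<le> p\<^sup>2"
  proof -
    have "(2::nat) ^ (p - 1) \<le> 2 ^ ((p - 1) * j)" using j by (intro power_increasing) auto
    also have "\<dots> \<le> p\<^sup>2" using le unfolding e .
    finally show ?thesis .
  qed
  have "p < 7"
  proof (rule ccontr)
    assume "\<not> p < 7"
    then have "7 \<le> p" by simp
    then have "p\<^sup>2 < 2 ^ (p - 1)"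
    proof (induction p rule: dec_induct)
      case (step n)
      have "3 * n \<le> n * n" using step by (intro mult_right_mono) auto
      then have "Suc (2 * n) \<le> n * n" using step by linarith
      then have "(Suc n)\<^sup>2 \<le> 2 * n\<^sup>2" by (simp add: power2_eq_square)
      also have "\<dots> < 2 * 2 ^ (n - 1)" using step by simp
      also have "\<dots> = 2 ^ (Suc n - 1)" using step by (cases n) auto
      finally show ?case .
    qed simp
    with j1 show False by simp
  qed
  moreover have "p \<noteq> 4" "p \<noteq> 6" 
    using prime_nat_not_dvd[of 4 2] prime_nat_not_dvd[of 6 2] p by auto
  ultimately have "p = 2 \<or> p = 3 \<or> p = 5" using p2 by auto
  then show ?thesis
  proof (elim disjE)
    assume p: "p = 2"
    then have "(2::nat) ^ j \<le> 2 ^ 2" using le e by simp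
    then have "j \<le> 2" by (rule power_le_imp_le_exp[rotated]) simp
    with j p show ?thesis by (auto simp: le_Suc_eq numeral_2_eq_2)
  next
    assume p: "p = 3"
    then have "(2::nat) ^ (2 * j) < 2 ^ 4" using le e by simp
    then have "2 * j < 4" by (rule power_less_imp_less_exp[rotated]) simp
    with j p show ?thesis by auto
  next
    assume p: "p = 5"
    then have "(2::nat) ^ (4 * j) < 2 ^ 5" using le e by simp
    then have "4 * j < 5" by (rule power_less_imp_less_exp[rotated]) simp
    with j p show ?thesis by auto
  qed
qed

text \<open>Taking \<open>j\<close>-th roots leaves
  \<open>p ^ p < 2 ^ ((p * j - 1) * (p - 1))\<close>. From \<open>p = 5\<close> on this follows from
  \<open>p < 2 ^ (p - 2)\<close> and \<open>(p - 2) * p \<le> (p - 1) * (p - 1)\<close>; for 2 and 3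
  it uses \<open>p * j \<ge> 4\<close>.\<close>

lemma order_bound_nonzero_cases:
  fixes p j :: nat
  assumes p: "prime p" and m: "p * j \<ge> 4"
  shows "p ^ (p * j) < 2 ^ ((p * j - 1) * (p * j - j))"
proof -
  have p2: "p \<ge> 2" using p by (rule prime_ge_2_nat)
  have j: "j > 0" using m by (cases j) auto
  have "p ^ p < 2 ^ ((p * j - 1) * (p - 1))"
  proof -
    consider "p = 2" | "p = 3" | "p = 4" | "p \<ge> 5" using p2 by linarith
    then show ?thesis
    proof cases
      case 1
      then have "(2::nat) ^ 2 < 2 ^ (2 * j - 1)" using m by (intro power_strict_increasing) auto
      with 1 show ?thesis by simp
    next
      case 2
      then have "j \<ge> 2" using m by simp
      then have "10 \<le> (3 * j - 1) * 2" by linarith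
      then have "(2::nat) ^ 10 \<le> 2 ^ ((3 * j - 1) * 2)" by (intro power_increasing) auto
      with 2 show ?thesis by simp
    next
      case 3
      with p show ?thesis using prime_nat_not_dvd[of 4 2] by simp
    next
      case 4
      then have "p < 2 ^ (p - 2)"
      proof (induction p rule: dec_induct)
        case (step n)
        then have "Suc n \<le> 2 * n" by simp
        also have "\<dots> < 2 * 2 ^ (n - 2)" using step by simp
        also have "\<dots> = 2 ^ (Suc n - 2)" using step by (simp flip: power_Suc add: Suc_diff_le)
        finally show ?case .
      qed simp
      then have "p ^ p < (2 ^ (p - 2)) ^ p" using 4 by (intro power_strict_mono) auto
      also have "\<dots> = 2 ^ ((p - 2) * p)" by (simp add: power_mult)
      also have "\<dots> \<le> 2 ^ ((p * j - 1) * (p - 1))"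
      proof (intro power_increasing)
        have "(p - 2) * p \<le> (p - 1) * (p - 1)" using 4 by (cases p) (auto simp: algebra_simps diff_mult_distrib)
        also have "p - 1 \<le> p * j - 1" using j by (intro diff_le_mono) auto
        then have "(p - 1) * (p - 1) \<le> (p * j - 1) * (p - 1)" by (rule mult_right_mono) simp
        finally show "(p - 2) * p \<le> (p * j - 1) * (p - 1)" .
      qed simp
      finally show ?thesis .
    qed
  qed
  then have "(p ^ p) ^ j < (2 ^ ((p * j - 1) * (p - 1))) ^ j"
    using j by (intro power_strict_mono) auto
  moreover have "p * j - j = (p - 1) * j" by (simp add: diff_mult_distrib)
  ultimately show ?thesis by (simp add: power_mult[symmetric] mult.assoc)
qed

section \<open>Vanishing coordinates and coordinates of small order\<close>

definition at_most_one_zero :: "'a::idom \<times> 'a \<times> 'a \<Rightarrow> bool" where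
  "at_most_one_zero = (\<lambda>(x, y, z). (x \<noteq> 0 \<or> y \<noteq> 0) \<and> (x \<noteq> 0 \<or> z \<noteq> 0) \<and> (y \<noteq> 0 \<or> z \<noteq> 0))"

lemma at_most_one_zero_orb:
  "s \<in> orb t \<Longrightarrow> at_most_one_zero t \<Longrightarrow> at_most_one_zero s"
  by (induction rule: orb.induct) (auto simp: at_most_one_zero_def)

text \<open>Completing the square gives \<open>markov \<ge> 4\<close>, and boundedness of the real
  orbit gives the opposite inequality.\<close>

lemma markov_of_plus_minus_2:
  assumes co: "cos_orbit (x, y, z)" and x: "x\<^sup>2 = 4"
  shows "markov (x, y, z) = 4"
proof -
  obtain r where r: "(x, y, z) = map3 complex_of_real r" "markov r \<le> 4"
    using cos_orbit_real[OF co] by blast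
  obtain a b c where abc: "r = (a, b, c)" by (cases r)
  have a: "a\<^sup>2 = 4" using x r(1) by (simp add: abc) (metis of_real_eq_iff of_real_numeral of_real_power)
  have "4 * (b\<^sup>2 + c\<^sup>2 - a * b * c) = (2 * b - a * c)\<^sup>2 + c\<^sup>2 * (4 - a\<^sup>2)"
    by (simp add: power2_eq_square algebra_simps)
  then have "4 * (b\<^sup>2 + c\<^sup>2 - a * b * c) \<ge> 0" using a by simp
  with r(2) a have "markov r = 4" by (simp add: abc)
  then show ?thesis using r(1) by (simp add: abc) (metis of_real_add of_real_diff of_real_mult of_real_numeral of_real_power)
qed

text \<open>The four conditions describe \<open>z + inverse z\<close> with \<open>z\<^sup>2\<close>
  of order 2, 3, 4 and 5. The last one says that \<open>x\<^sup>2\<close> is the square of the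
  golden ratio or of its inverse.\<close>

definition special :: "complex \<Rightarrow> bool" where
  "special x \<longleftrightarrow> x = 0 \<or> x\<^sup>2 = 1 \<or> x\<^sup>2 = 2 \<or> (x\<^sup>2)\<^sup>2 - 3 * x\<^sup>2 + 1 = 0"

text \<open>With \<open>w = z\<^sup>2\<close> one has
  \<open>w * x\<^sup>2 = (w + 1)\<^sup>2\<close>. Cancelling from \<open>w ^ m - 1\<close> the
  factors that the order excludes leaves a cyclotomic equation for \<open>w\<close>, which becomes
  one for \<open>x\<^sup>2\<close>.\<close>

lemma special_of_order:
  assumes prim: "primitive_root_of_unity (z\<^sup>2) m" and x: "x = z + inverse z" 
  shows "m = 1 \<Longrightarrow> x\<^sup>2 = 4" "m = 2 \<Longrightarrow> x = 0" "m = 3 \<Longrightarrow> x\<^sup>2 = 1" "m = 4 \<Longrightarrow> x\<^sup>2 = 2"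
    "m = 5 \<Longrightarrow> (x\<^sup>2)\<^sup>2 - 3 * x\<^sup>2 + 1 = 0"
proof -
  define w where "w = z\<^sup>2"
  have w: "m > 0" "w ^ m = 1" "\<And>d. 0 < d \<Longrightarrow> d < m \<Longrightarrow> w ^ d \<noteq> 1"
    using prim by (auto simp: primitive_root_of_unity_def w_def)
  have w0: "w \<noteq> 0" using w(1,2) by (auto simp: power_0_left)
  then have z0: "z \<noteq> 0" by (auto simp: w_def)
  have x2: "w * x\<^sup>2 = w\<^sup>2 + 2 * w + 1"
    using z0 by (simp add: x w_def field_simps power2_eq_square)
  have w1: "w \<noteq> 1" if "m > 1" using w(3)[of 1] that by simp
  show "x\<^sup>2 = 4" if "m = 1" using x2 w(2) that by simp
  show "x = 0" if "m = 2"
  proof -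
    have "(w - 1) * (w + 1) = 0" using w(2) that by (simp add: algebra_simps power2_eq_square)
    then have "w = - 1" using w1 that by (simp add: eq_neg_iff_add_eq_0)
    then show ?thesis using x2 by simp
  qed
  show "x\<^sup>2 = 1" if "m = 3"
  proof -
    have "(w - 1) * (w\<^sup>2 + w + 1) = 0" using w(2) that by (simp add: algebra_simps power2_eq_square power3_eq_cube)
    then have "w\<^sup>2 + w + 1 = 0" using w1 that by simp
    then have "w * x\<^sup>2 = w * 1" using x2 by (simp add: algebra_simps)
    then show ?thesis using w0 by simp
  qed
  show "x\<^sup>2 = 2" if "m = 4"
  proof -
    have "w\<^sup>2 \<noteq> 1" using w(3)[of 2] that by simp
    moreover have "(w\<^sup>2 - 1) * (w\<^sup>2 + 1) = 0" using w(2) that by (simp add: algebra_simps power2_eq_square power4_eq_xxxx)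
    ultimately have "w\<^sup>2 + 1 = 0" by simp
    then have "w * x\<^sup>2 = w * 2" using x2 by (simp add: algebra_simps)
    then show ?thesis using w0 by simp
  qed
  show "(x\<^sup>2)\<^sup>2 - 3 * x\<^sup>2 + 1 = 0" if "m = 5"
  proof -
    have "(w - 1) * (w ^ 4 + w ^ 3 + w\<^sup>2 + w + 1) = w ^ 5 - 1" 
      by (simp add: algebra_simps eval_nat_numeral)
    then have "w ^ 4 + w ^ 3 + w\<^sup>2 + w + 1 = 0" using w(2) w1 that by simp
    moreover have "w\<^sup>2 * ((x\<^sup>2)\<^sup>2 - 3 * x\<^sup>2 + 1) = (w * x\<^sup>2)\<^sup>2 - 3 * w * (w * x\<^sup>2) + w\<^sup>2"
      by (simp add: algebra_simps power2_eq_square)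
    moreover have "(w\<^sup>2 + 2 * w + 1)\<^sup>2 - 3 * w * (w\<^sup>2 + 2 * w + 1) + w\<^sup>2 = w ^ 4 + w ^ 3 + w\<^sup>2 + w + 1"
      by (simp add: algebra_simps eval_nat_numeral)
    ultimately have "w\<^sup>2 * ((x\<^sup>2)\<^sup>2 - 3 * x\<^sup>2 + 1) = 0" unfolding x2 by simp
    then show ?thesis using w0 by simp
  qed
qed

text \<open>Let \<open>m\<close> be the order of \<open>u\<^sup>2\<close>. If
  \<open>m \<ge> 4\<close>, the bound for nonvanishing rotations fails, so some entry on the conic
  is zero; the bound for a zero coordinate, applied at that triple, leaves only 4 and 5.\<close>

lemma first_coordinate_special:
  assumes co: "cos_orbit (x, y, z)" and ne4: "markov (x, y, z) \<noteq> 4"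
    and adm: "at_most_one_zero (x, y, z)"
  shows "special x" and "x = 0 \<or> x\<^sup>2 = 1 \<or> (\<exists>v. (x, 0, v) \<in> orb (x, y, z))"
proof -
  have "x \<in> two_cos" using cos_orbitD[OF co orb_base] by blast
  then obtain u n where u: "n > 0" "u ^ n = 1" and x: "x = u + inverse u"
    by (auto simp: two_cos_def)
  have "(u\<^sup>2) ^ n = 1" using u(2) by (metis mult.commute power_mult power_one)
  then obtain m where m: "primitive_root_of_unity (u\<^sup>2) m"
    using primitive_root_of_unity_exists[OF u(1)] by blast
  note order = special_of_order[OF m x]
  have m0: "m > 0" using m by (simp add: primitive_root_of_unity_def)
  have m1: "m \<noteq> 1" using order(1) markov_of_plus_minus_2[OF co] ne4 by blast
  have large: "(\<exists>v. (x, 0, v) \<in> orb (x, y, z)) \<and> m \<in> {4, 5}" if m4: "m \<ge> 4"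
  proof -
    obtain p where p: "prime p" "p dvd m" using prime_factor_nat[OF m1] by blast
    then obtain j where j: "m = p * j" by blast
    have p0: "p > 0" using p(1) prime_gt_0_nat by blast
    have "\<exists>k. rotation x y z k = 0"
    proof (rule ccontr)
      assume "\<nexists>k. rotation x y z k = 0"
      then have "2 ^ ((p * j - 1) * (p * j - j)) \<le> p ^ (p * j)"
        using m4 by (intro order_bound_nonzero[OF co ne4 _ m[unfolded j] x p0]) (auto simp: j)
      with order_bound_nonzero_cases[OF p(1), of j] m4 show False by (simp add: j)
    qed
    then obtain k where k: "rotation x y z k = 0" by blast
    define v where "v = rotation x y z (Suc k)"
    have v: "(x, 0, v) \<in> orb (x, y, z)" using rotation_orb[of x y z k] by (simp add: k v_def)
    have "v \<noteq> 0" using at_most_one_zero_orb[OF v adm] by (simp add: at_most_one_zero_def)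
    moreover have "markov (x, 0, v) \<noteq> 4" using markov_orb[OF v] ne4 by metis
    ultimately have "2 ^ (p * j - j) \<le> p\<^sup>2"
      using m4 by (intro order_bound_zero[OF cos_orbit_orb[OF co v] _ _ m[unfolded j] x p0]) (auto simp: j)
    then have "m \<in> {2, 3, 4, 5}"
      unfolding j using m0 by (intro order_bound_zero_cases[OF p(1)]) (auto simp: j)
    with m4 v show ?thesis by auto
  qed
  consider "m = 2" | "m = 3" | "m \<ge> 4" using m0 m1 by linarith
  then show "special x" by cases (use order large in \<open>auto simp: special_def\<close>)
  consider "m = 2" | "m = 3" | "m \<ge> 4" using m0 m1 by linarith
  then show "x = 0 \<or> x\<^sup>2 = 1 \<or> (\<exists>v. (x, 0, v) \<in> orb (x, y, z))"
    by cases (use order large in auto)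
qed

text \<open>Otherwise all orbit coordinates have square 1, so \<open>markov\<close> is 2 or 4. The
  value 4 is excluded, and for 2 one has \<open>z = x * y\<close>, so that a Vieta move produces a
  zero after all.\<close>

lemma orbit_contains_zero:
  assumes co: "cos_orbit t" and ne4: "markov t \<noteq> 4" and adm: "at_most_one_zero t"
  shows "\<exists>u v. (0, u, v) \<in> orb t"
proof -
  obtain x y z where t: "t = (x, y, z)" by (cases t)
  have *: "(\<exists>u v. (0, u, v) \<in> orb t) \<or> a\<^sup>2 = 1" if abc: "(a, b, c) \<in> orb t" for a b c
  proof -
    have "a = 0 \<or> a\<^sup>2 = 1 \<or> (\<exists>v. (a, 0, v) \<in> orb (a, b, c))"
      using first_coordinate_special(2)[OF cos_orbit_orb[OF co abc]]
        markov_orb[OF abc] ne4 at_most_one_zero_orb[OF abc adm] by simp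
    then show ?thesis using abc orb_trans[OF abc] orb_coords(1) by blast
  qed
  have base: "(x, y, z) \<in> orb t" using orb_base[of t] by (simp add: t)
  show ?thesis
  proof (rule ccontr)
    assume no: "\<not> ?thesis"
    have sq: "x\<^sup>2 = 1" "y\<^sup>2 = 1" "z\<^sup>2 = 1" using * orb_coords[OF base] base no by blast+
    have "markov t = 3 - x * y * z" by (simp add: t sq)
    moreover have "(x * y * z)\<^sup>2 = 1" by (simp add: power_mult_distrib sq)
    then have "x * y * z = 1 \<or> x * y * z = - 1" by (simp add: power2_eq_1_iff)
    ultimately have "x * y * z = 1" using ne4 by auto
    then have "x * y * z\<^sup>2 = z" by (simp add: power2_eq_square algebra_simps)
    then have "x * y - z = 0" by (simp add: sq)
    then have "(x, 0, y) \<in> orb t" using orb_1[OF base] by simp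
    then show False using orb_coords(1) no by blast
  qed
qed

section \<open>Orbits over the golden field\<close>

text \<open>The inverse of the golden ratio; the golden ratio itself is
  \<open>psi + 1\<close>.\<close>

definition psi :: real where "psi = 2 * cos (2 * pi / 5)"

lemma
  shows cos_pi_fifth: "2 * cos (pi / 5) = psi + 1" and psi_square: "psi\<^sup>2 = 1 - psi"
    and psi_pos: "psi > 0"
proof -
  define phi :: real where "phi = 2 * cos (pi / 5)"
  have "3 * pi / 5 = pi - 2 * pi / 5" "4 * pi / 5 = pi - pi / 5" by simp_all
  then have c3: "cos (3 * pi / 5) = - cos (2 * pi / 5)" and c4: "cos (4 * pi / 5) = - cos (pi / 5)"
    by (simp_all only: cos_pi_minus)
  have "cos (2 * pi / 5 - pi / 5) + cos (2 * pi / 5 + pi / 5) = 2 * cos (2 * pi / 5) * cos (pi / 5)"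
    by (simp only: cos_diff cos_add)
  then have "2 * cos (2 * pi / 5) * cos (pi / 5) = cos (pi / 5) + cos (3 * pi / 5)" by simp
  moreover have "phi * psi = 2 * (2 * cos (2 * pi / 5) * cos (pi / 5))"
    by (simp add: phi_def psi_def)
  ultimately have prod: "phi * psi = phi - psi" using c3 by (simp add: phi_def psi_def)
  have phi2: "phi\<^sup>2 = 2 + psi"
    using cos_double_cos[of "pi / 5"] by (simp add: phi_def psi_def power_mult_distrib)
  have psi2: "psi\<^sup>2 = 2 - phi"
    using cos_double_cos[of "2 * pi / 5"] c4 by (simp add: phi_def psi_def power_mult_distrib)
  have "phi > 0" "psi > 0" unfolding phi_def psi_def by (simp_all add: cos_gt_zero)
  \<comment> \<open>The double-angle values \<open>2 + psi\<close> of \<open>phi\<^sup>2\<close> and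
    \<open>2 - phi\<close> of \<open>psi\<^sup>2\<close> differ by \<open>phi + psi\<close>, which
    is positive and cancels.\<close>
  moreover have "(phi - psi) * (phi + psi) = 1 * (phi + psi)"
    using phi2 psi2 by (simp add: power2_eq_square algebra_simps)
  ultimately have "phi - psi = 1" by simp
  with psi2 \<open>psi > 0\<close> show "2 * cos (pi / 5) = psi + 1" "psi\<^sup>2 = 1 - psi" "psi > 0"
    by (simp_all add: phi_def)
qed

lemma psi_bounds: "618 / 1000 < psi" "psi < 6181 / 10000"
proof -
  show "618 / 1000 < psi"
  proof (rule ccontr)
    assume "\<not> 618 / 1000 < psi"
    then have "psi\<^sup>2 \<le> (618 / 1000)\<^sup>2" using psi_pos by (intro power_mono) auto
    then show False using psi_square \<open>\<not> 618 / 1000 < psi\<close> by (simp add: power2_eq_square)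
  qed
  show "psi < 6181 / 10000"
  proof (rule ccontr)
    assume "\<not> psi < 6181 / 10000"
    then have "(6181 / 10000)\<^sup>2 \<le> psi\<^sup>2" by (intro power_mono) auto
    then show False using psi_square \<open>\<not> psi < 6181 / 10000\<close> by (simp add: power2_eq_square)
  qed
qed

text \<open>As rewrite rules these make every polynomial in \<open>psi\<close> linear, after which
  \<open>psi_bounds\<close> and linear arithmetic decide; the second rule catches
  \<open>psi * psi\<close> inside a longer product.\<close>

lemma psi_mult: "psi * psi = 1 - psi" "psi * (psi * x) = x - psi * x"
proof -
  show *: "psi * psi = 1 - psi" using psi_square by (simp add: power2_eq_square)
  have "psi * (psi * x) = (psi * psi) * x" by (rule mult.assoc[symmetric])
  also have "\<dots> = x - psi * x" unfolding * by (simp add: left_diff_distrib)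
  finally show "psi * (psi * x) = x - psi * x" .
qed

lemma trig_coordinates:
  "- 2 * cos (pi * (1 / 2)) = 0" "- 2 * cos (pi * (1 / 3)) = - 1" "- 2 * cos (pi * (2 / 3)) = 1"
  "- 2 * cos (pi * (1 / 4)) = - sqrt 2" "- 2 * cos (pi * (1 / 5)) = - (psi + 1)"
  "- 2 * cos (pi * (2 / 5)) = - psi" "- 2 * cos (pi * (3 / 5)) = psi"
  "- 2 * cos (pi * (4 / 5)) = psi + 1"
proof -
  have "pi * (3 / 5) = pi - 2 * pi / 5" "pi * (4 / 5) = pi - pi / 5" by simp_all
  then have "cos (pi * (3 / 5)) = - cos (2 * pi / 5)" "cos (pi * (4 / 5)) = - cos (pi / 5)"
    by (simp_all only: cos_pi_minus)
  then show "- 2 * cos (pi * (3 / 5)) = psi" "- 2 * cos (pi * (4 / 5)) = psi + 1"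
    using cos_pi_fifth by (simp_all add: psi_def)
  show "- 2 * cos (pi * (1 / 5)) = - (psi + 1)" "- 2 * cos (pi * (2 / 5)) = - psi"
    using cos_pi_fifth by (simp_all add: psi_def mult.commute)
  show "- 2 * cos (pi * (2 / 3)) = 1" using cos_120 by (simp add: mult.commute)
qed (simp_all add: cos_45 cos_60)

text \<open>Each move is a Vieta move on a reordered triple, and \<open>markov\<close> is symmetric
  and constant on the orbit, so \<open>F\<close> has to be closed only on one level set.\<close>

lemma orb_subset_cube:
  assumes t: "t \<in> F \<times> F \<times> F"
    and F: "\<And>x y z. x \<in> F \<Longrightarrow> y \<in> F \<Longrightarrow> z \<in> F \<Longrightarrow> markov (x, y, z) = markov t \<Longrightarrow> x * y - z \<in> F"
  shows "orb t \<subseteq> F \<times> F \<times> F"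
proof
  fix s assume "s \<in> orb t"
  then show "s \<in> F \<times> F \<times> F"
  proof induction
    case (orb_1 x y z)
    have "markov (x, y, z) = markov t"
      using markov_orb[OF orb_1(1)] by (simp add: algebra_simps)
    then have "x * y - z \<in> F" using orb_1(2) by (intro F) (auto simp del: markov.simps)
    then show ?case using orb_1(2) by (simp add: mult.commute)
  next
    case (orb_1' x y z)
    have "markov (x, z, y) = markov t"
      using markov_orb[OF orb_1'(1)] by (simp add: algebra_simps)
    then have "x * z - y \<in> F" using orb_1'(2) by (intro F) (auto simp del: markov.simps)
    then show ?case using orb_1'(2) by (simp add: mult.commute)
  next
    case (orb_2 x y z)
    have "markov (y, z, x) = markov t"
      using markov_orb[OF orb_2(1)] by (simp add: algebra_simps)
    then have "y * z - x \<in> F" using orb_2(2) by (intro F) (auto simp del: markov.simps)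
    then show ?case using orb_2(2) by (simp add: mult.commute)
  next
    case (orb_2' x y z)
    have "markov (x, y, z) = markov t"
      using markov_orb[OF orb_2'(1)] by (simp add: algebra_simps)
    then have "x * y - z \<in> F" using orb_2'(2) by (intro F) (auto simp del: markov.simps)
    then show ?case using orb_2'(2) by (simp add: mult.commute)
  qed (rule t)
qed

section \<open>Finite value sets closed under Vieta moves\<close>

definition golden_values :: "real set" where
  "golden_values = {0, 1, - 1, psi, - psi, psi + 1, - (psi + 1)}"



lemma golden_values_uminus: "x \<in> golden_values \<Longrightarrow> - x \<in> golden_values"
  by (auto simp: golden_values_def)

text \<open>A finite check. Off the given levels, products such as
  \<open>(psi + 1) * (psi + 1)\<close> would leave the set; the three levels are those of the base
  triples with golden coordinates.\<close>

lemma golden_values_vieta_pos: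
  assumes "x \<in> {1, psi, psi + 1}" "y \<in> {1, psi, psi + 1}" "z \<in> golden_values"
    and "markov (x, y, z) \<in> {3, psi + 3, 2 - psi}"
  shows "x * y - z \<in> golden_values"
  using assms unfolding golden_values_def
  by (elim insertE emptyE; hypsubst)
    (simp_all add: power2_eq_square algebra_simps psi_mult, (rule FalseE, use psi_bounds in linarith)+)

text \<open>Changing two signs reduces this to positive \<open>x\<close> and \<open>y\<close>.\<close>

lemma golden_values_vieta:
  assumes x: "x \<in> golden_values" and y: "y \<in> golden_values" and z: "z \<in> golden_values"
    and c: "markov (x, y, z) \<in> {3, psi + 3, 2 - psi}"
  shows "x * y - z \<in> golden_values"
proof -
  have z': "- z \<in> golden_values" using z by (rule golden_values_uminus)
  have "a = 0 \<or> a \<in> {1, psi, psi + 1} \<or> - a \<in> {1, psi, psi + 1}" if "a \<in> golden_values" for a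
    using that by (auto simp: golden_values_def)
  from this[OF x] this[OF y] consider "x = 0 \<or> y = 0" | "x \<in> {1, psi, psi + 1}" "y \<in> {1, psi, psi + 1}"
    | "- x \<in> {1, psi, psi + 1}" "y \<in> {1, psi, psi + 1}"
    | "x \<in> {1, psi, psi + 1}" "- y \<in> {1, psi, psi + 1}"
    | "- x \<in> {1, psi, psi + 1}" "- y \<in> {1, psi, psi + 1}"
    by blast
  then show ?thesis
  proof cases
    case 1
    then show ?thesis using z' by auto
  next
    case 2
    then show ?thesis using z c by (rule golden_values_vieta_pos)
  next
    case 3
    have "(- x) * y - (- z) \<in> golden_values"
      using 3 z' by (rule golden_values_vieta_pos) (use c in simp)
    from golden_values_uminus[OF this] show ?thesis by simp
  next
    case 4
    have "x * (- y) - (- z) \<in> golden_values"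
      using 4 z' by (rule golden_values_vieta_pos) (use c in simp)
    from golden_values_uminus[OF this] show ?thesis by simp
  next
    case 5
    have "(- x) * (- y) - z \<in> golden_values"
      using 5 z by (rule golden_values_vieta_pos) (use c in simp)
    then show ?thesis by simp
  qed
qed

text \<open>The analogous check for the first two base triples, whose levels are 2 and 3.\<close>

lemma sqrt2_values_vieta:
  fixes x y z :: real
  defines "F \<equiv> {0, 1, - 1, sqrt 2, - sqrt 2}"
  assumes "x \<in> F" "y \<in> F" "z \<in> F" and "markov (x, y, z) \<in> {2, 3}"
  shows "x * y - z \<in> F"
proof -
  have b: "1.4 < sqrt 2" "sqrt 2 < (1.5 :: real)"
    by (rule real_less_rsqrt real_less_lsqrt; simp add: power2_eq_square)+
  show ?thesis
    using assms(2-) unfolding F_def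
    by (elim insertE emptyE; hypsubst; simp add: power2_eq_square algebra_simps;
        use b in linarith)
qed

section \<open>Braid orbits of triple classes\<close>

lemma cls_eq_iff: "cls s = cls t \<longleftrightarrow> sign_eq s t"
  by (simp add: cls.abs_eq triple_class.abs_eq_iff)

lemma mem_braid_orbit_iff: "X \<in> braid_orbit t \<longleftrightarrow> (\<exists>w. X = cls (word_act w t))"
proof
  assume "X \<in> braid_orbit t"
  then obtain b where b: "X = cls (braid_act b t)"
    by (auto simp: braid_orbit_def orbit_def class_act_cls)
  show "\<exists>w. X = cls (word_act w t)"
    unfolding b by (induction b rule: braid.abs_induct) (auto simp: braid_act.abs_eq)
next
  assume "\<exists>w. X = cls (word_act w t)"
  then obtain w where "X = cls (braid_act (abs_braid w) t)" by (auto simp: braid_act.abs_eq)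
  then show "X \<in> braid_orbit t"
    by (auto simp: braid_orbit_def orbit_def class_act_cls[symmetric] B3_def)
qed

lemma letter_act_simps:
  "letter_act (Beta1, False) (x, y, z) = (- x, z - x * y, y)"
  "letter_act (Beta1, True) (x, y, z) = (- x, z, y - x * z)"
  "letter_act (Beta2, False) (x, y, z) = (z, - y, x - y * z)"
  "letter_act (Beta2, True) (x, y, z) = (z - x * y, - y, x)"
  by (simp_all add: letter_act_def inv_gen_act_Beta1 inv_gen_act_Beta2)

lemma braid_orbit_letter:
  assumes "cls s \<in> braid_orbit t" shows "cls (letter_act l s) \<in> braid_orbit t"
proof -
  obtain w where "cls s = cls (word_act w t)" using assms by (auto simp: mem_braid_orbit_iff)
  then have "sign_eq (word_act [l] s) (word_act [l] (word_act w t))"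
    unfolding cls_eq_iff by (rule sign_eq_word_act)
  then have "cls (letter_act l s) = cls (word_act (l # w) t)"
    by (simp add: cls_eq_iff word_act_def)
  then show ?thesis unfolding mem_braid_orbit_iff by blast
qed

lemma braid_orbit_moves:
  assumes "cls (x, y, z) \<in> braid_orbit t"
  shows "cls (x, x * y - z, y) \<in> braid_orbit t" "cls (x, z, x * z - y) \<in> braid_orbit t"
    "cls (z, y, y * z - x) \<in> braid_orbit t" "cls (x * y - z, y, x) \<in> braid_orbit t"
proof -
  have "cls (x, x * y - z, y) = cls (letter_act (Beta1, False) (x, y, z))"
    "cls (x, z, x * z - y) = cls (letter_act (Beta1, True) (x, y, z))"
    "cls (z, y, y * z - x) = cls (letter_act (Beta2, False) (x, y, z))"
    "cls (x * y - z, y, x) = cls (letter_act (Beta2, True) (x, y, z))"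
    by (simp_all add: letter_act_simps cls_eq_iff)
  then show "cls (x, x * y - z, y) \<in> braid_orbit t" "cls (x, z, x * z - y) \<in> braid_orbit t"
    "cls (z, y, y * z - x) \<in> braid_orbit t" "cls (x * y - z, y, x) \<in> braid_orbit t"
    using braid_orbit_letter[OF assms] by metis+
qed

lemma braid_orbit_base: "cls t \<in> braid_orbit t"
  unfolding mem_braid_orbit_iff by (rule exI[of _ "[]"]) (simp add: word_act_def)

lemma braid_orbit_orb:
  assumes "s \<in> orb r" "cls r \<in> braid_orbit t" shows "cls s \<in> braid_orbit t"
  using assms by induction (auto intro: braid_orbit_moves)

text \<open>Braid words respect sign changes, and each letter is one of the moves up to changing two
  signs, so the orbit of the class can be followed on representatives.\<close>

lemma braid_orbit_eq: "braid_orbit t = cls ` orb t"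
proof (intro equalityI subsetI)
  fix X assume "X \<in> cls ` orb t"
  then show "X \<in> braid_orbit t" using braid_orbit_orb braid_orbit_base by blast
next
  fix X assume "X \<in> braid_orbit t"
  then obtain w where X: "X = cls (word_act w t)" by (auto simp: mem_braid_orbit_iff)
  have "cls (word_act w t) \<in> cls ` orb t"
  proof (induction w)
    case Nil
    then show ?case by (simp add: word_act_def orb_base)
  next
    case (Cons l w)
    then obtain s where s: "s \<in> orb t" "cls (word_act w t) = cls s" by auto
    obtain x y z where xyz: "s = (x, y, z)" by (cases s)
    have "sign_eq (word_act [l] (word_act w t)) (word_act [l] s)"
      using s(2) unfolding cls_eq_iff by (rule sign_eq_word_act)
    then have eq: "cls (word_act (l # w) t) = cls (letter_act l s)"
      by (simp add: cls_eq_iff word_act_def)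
    have "\<exists>r\<in>orb t. sign_eq (letter_act l s) r"
    proof -
      obtain g e where l: "l = (g, e)" by (cases l)
      show ?thesis
      proof (cases g; cases e)
        assume "g = Beta1" "e"
        then show ?thesis using orb_1'[OF s(1)[unfolded xyz]]
          by (intro bexI) (auto simp: l xyz letter_act_simps)
      next
        assume "g = Beta1" "\<not> e"
        then show ?thesis using orb_1[OF s(1)[unfolded xyz]]
          by (intro bexI) (auto simp: l xyz letter_act_simps)
      next
        assume "g = Beta2" "e"
        then show ?thesis using orb_2'[OF s(1)[unfolded xyz]]
          by (intro bexI) (auto simp: l xyz letter_act_simps)
      next
        assume "g = Beta2" "\<not> e"
        then show ?thesis using orb_2[OF s(1)[unfolded xyz]]
          by (intro bexI) (auto simp: l xyz letter_act_simps)
      qed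
    qed
    then show ?case by (auto simp: eq cls_eq_iff simp del: sign_eq.simps)
  qed
  with X show "X \<in> cls ` orb t" by simp
qed

text \<open>A class determines the first coordinate only up to sign, which is harmless as
  \<open>two_cos\<close> is closed under negation.\<close>

lemma good_cos_orbit:
  assumes "good t" shows "cos_orbit t"
  unfolding cos_orbit_def
proof (intro ballI, clarify)
  fix x y z assume "(x, y, z) \<in> orb t"
  then have "cls (x, y, z) \<in> braid_orbit t" by (simp add: braid_orbit_eq)
  then obtain b where b: "b \<in> carrier B3" "cls (x, y, z) = class_act b (cls t)"
    unfolding braid_orbit_def orbit_def by blast
  have "\<forall>b\<in>carrier B3. \<exists>r1\<in>\<rat> \<inter> {0..1}. \<exists>r2\<in>\<rat> \<inter> {0..1}. \<exists>r3\<in>\<rat> \<inter> {0..1}.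
      class_act b (cls t) = cls (trig_triple r1 r2 r3)"
    using assms unfolding good_def by (rule conjunct2)
  from bspec[OF this b(1)] obtain r1 r2 r3 where r: "r1 \<in> \<rat>" "cls (x, y, z) = cls (trig_triple r1 r2 r3)"
    unfolding b(2) by blast
  have "complex_of_real (2 * cos (pi * r1)) \<in> two_cos" using r(1) by (rule two_cos_cos_Rats)
  moreover have "x = of_real (2 * cos (pi * r1)) \<or> x = - of_real (2 * cos (pi * r1))"
    using r(2) by (auto simp: cls_eq_iff trig_triple_def)
  ultimately show "x \<in> two_cos" using two_cos_uminus by blast
qed

lemma good_at_most_one_zero: "good t \<Longrightarrow> at_most_one_zero t"
  by (cases t) (auto simp: good_def at_most_one_zero_def split: if_splits)

section \<open>Orbits containing all permutations of a triple\<close>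

definition all_permutations_in :: "triple_class set \<Rightarrow> triple \<Rightarrow> bool" where
  "all_permutations_in X t \<longleftrightarrow> (\<forall>s\<in>permuted t. cls s \<in> X)"

lemma all_permutations_in_permute:
  assumes "all_permutations_in X (x, y, z)"
  shows "all_permutations_in X (x, z, y)" "all_permutations_in X (y, x, z)"
    "all_permutations_in X (y, z, x)" "all_permutations_in X (z, x, y)" "all_permutations_in X (z, y, x)"
  using assms by (auto simp: all_permutations_in_def)

lemma all_permutations_in_sign:
  assumes "all_permutations_in X (x, y, z)"
  shows "all_permutations_in X (x, - y, - z)" "all_permutations_in X (- x, y, - z)"
    "all_permutations_in X (- x, - y, z)"
proof -
  have eq: "cls (a, - b, - c) = cls (a, b, c)" "cls (- a, b, - c) = cls (a, b, c)"
    "cls (- a, - b, c) = cls (a, b, c)" for a b c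
    by (simp_all add: cls_eq_iff)
  show "all_permutations_in X (x, - y, - z)" "all_permutations_in X (- x, y, - z)"
    "all_permutations_in X (- x, - y, z)"
    using assms by (auto simp: all_permutations_in_def eq)
qed

text \<open>Any single sign can be changed by flipping the zero along with it, and suitable moves
  merely permute the coordinates of a triple with a zero, up to sign.\<close>

lemma all_permutations_in_zero:
  assumes "cls (0, x, y) \<in> braid_orbit t"
  shows "all_permutations_in (braid_orbit t) (0, x, y)"
proof -
  have neg: "cls (0, - a, b) = cls (0, a, b)" "cls (- a, 0, b) = cls (a, 0, b)"
    "cls (- a, b, 0) = cls (a, b, 0)" "cls (0, a, - b) = cls (0, a, b)" 
    "cls (a, 0, - b) = cls (a, 0, b)" "cls (a, - b, 0) = cls (a, b, 0)" for a b
    by (simp_all add: cls_eq_iff)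
  have swap: "cls (0, b, a) \<in> braid_orbit t" if "cls (0, a, b) \<in> braid_orbit t" for a b
    using braid_orbit_moves(1)[OF that] by (simp add: neg)
  have last: "cls (a, b, 0) \<in> braid_orbit t" if "cls (0, a, b) \<in> braid_orbit t" for a b
    using braid_orbit_moves(4)[OF swap[OF that]] by (simp add: neg)
  have mid: "cls (a, 0, b) \<in> braid_orbit t" if "cls (0, a, b) \<in> braid_orbit t" for a b
    using braid_orbit_moves(2)[OF last[OF that]] by (simp add: neg)
  show ?thesis
    unfolding all_permutations_in_def
    using assms swap[OF assms] last[OF assms] last[OF swap[OF assms]] mid[OF assms] mid[OF swap[OF assms]]
    by auto
qed

lemma all_permutations_in_vieta:
  assumes "all_permutations_in (braid_orbit t) (x, y, z)"
  shows "all_permutations_in (braid_orbit t) (x, y, x * y - z)"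
proof -
  have "cls (x, y, z) \<in> braid_orbit t" "cls (y, x, z) \<in> braid_orbit t" "cls (z, y, x) \<in> braid_orbit t"
    "cls (z, x, y) \<in> braid_orbit t"
    using assms by (simp_all add: all_permutations_in_def)
  note m = this[THEN braid_orbit_moves(1)] this[THEN braid_orbit_moves(3)] this[THEN braid_orbit_moves(4)]
  show ?thesis
    using m by (simp add: all_permutations_in_def mult.commute[of y x])
qed

section \<open>The classification\<close>

definition base_pairs :: "(real \<times> real) list" where
  "base_pairs = [(1, 1), (1, sqrt 2), (1, psi + 1), (1, psi), (psi + 1, psi)]"

lemma less_5_cases: "i < (5 :: nat) \<Longrightarrow> i = 0 \<or> i = 1 \<or> i = 2 \<or> i = 3 \<or> i = 4"
  by auto

lemma trig_triple_base:
  assumes "i < 5"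
  shows "base_triples ! i = map3 of_real (0, - fst (base_pairs ! i), - snd (base_pairs ! i))"
  using less_5_cases[OF assms]
  by (elim disjE)
    (simp_all only: base_triples_def base_pairs_def trig_triple_def trig_coordinates nth_Cons_0
      nth_Cons_numeral nth_Cons_Suc One_nat_def pred_numeral_simps fst_conv snd_conv map3_simp eval_nat_numeral BitM.simps)

lemma braid_orbit_base_permutations:
  assumes "i < 5"
  shows "all_permutations_in (braid_orbit (base_triples ! i))
    (0, of_real (fst (base_pairs ! i)), of_real (snd (base_pairs ! i)))"
proof -
  define a b where "a = complex_of_real (fst (base_pairs ! i))" and "b = complex_of_real (snd (base_pairs ! i))"
  have "base_triples ! i = (0, - a, - b)" using trig_triple_base[OF assms] by (simp add: a_def b_def)
  then have "cls (0, - a, - b) \<in> braid_orbit (base_triples ! i)"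
    using braid_orbit_base[of "base_triples ! i"] by simp
  from all_permutations_in_sign(1)[OF all_permutations_in_zero[OF this]] show ?thesis
    by (simp add: a_def b_def)
qed

lemma special_real_square:
  assumes "special (of_real a)" "a \<noteq> 0"
  shows "a\<^sup>2 \<in> {1, 2, psi + 2, 1 - psi}"
proof -
  have "complex_of_real (a\<^sup>2) = of_real 1 \<or> complex_of_real (a\<^sup>2) = of_real 2 \<or>
      complex_of_real ((a\<^sup>2)\<^sup>2 - 3 * a\<^sup>2 + 1) = of_real 0"
    using assms by (simp add: special_def)
  then have "a\<^sup>2 = 1 \<or> a\<^sup>2 = 2 \<or> (a\<^sup>2)\<^sup>2 - 3 * a\<^sup>2 + 1 = 0"
    unfolding of_real_eq_iff .
  moreover have "(a\<^sup>2)\<^sup>2 - 3 * a\<^sup>2 + 1 = (a\<^sup>2 - (psi + 2)) * (a\<^sup>2 - (1 - psi))"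
    using psi_square by (simp add: power2_eq_square algebra_simps)
  ultimately show ?thesis by auto
qed

text \<open>The product \<open>u * v\<close> is a coordinate in the orbit of
  \<open>(0, u, v)\<close>, whence its hypothesis. Of the 16 pairs of squares it removes six and
  \<open>ne4\<close> removes \<open>(2, 2)\<close>; the nine left are the five base pairs up to
  order.\<close>

lemma special_pairs:
  assumes u: "special (of_real u)" "u \<noteq> 0" and v: "special (of_real v)" "v \<noteq> 0"
    and uv: "special (of_real (u * v))" and ne4: "u\<^sup>2 + v\<^sup>2 \<noteq> 4"
  shows "\<exists>i<5. (\<bar>u\<bar>, \<bar>v\<bar>) = base_pairs ! i \<or> (\<bar>v\<bar>, \<bar>u\<bar>) = base_pairs ! i"
proof -
  have U: "u\<^sup>2 \<in> {1, 2, psi + 2, 1 - psi}" and V: "v\<^sup>2 \<in> {1, 2, psi + 2, 1 - psi}"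
    using u v special_real_square by blast+
  have UV: "u\<^sup>2 * v\<^sup>2 \<in> {1, 2, psi + 2, 1 - psi}"
    using special_real_square[OF uv] u v by (simp add: power_mult_distrib)
  have pairs: "(u\<^sup>2, v\<^sup>2) \<in> {(1, 1), (1, 2), (2, 1), (1, psi + 2), (psi + 2, 1), (1, 1 - psi), (1 - psi, 1),
      (psi + 2, 1 - psi), (1 - psi, psi + 2)}"
    using U V
  proof (elim insertE emptyE)
    assume "u\<^sup>2 = 2" "v\<^sup>2 = psi + 2"
    then show ?thesis using UV psi_bounds by auto
  next
    assume "u\<^sup>2 = psi + 2" "v\<^sup>2 = 2"
    then show ?thesis using UV psi_bounds by auto
  next
    assume "u\<^sup>2 = 2" "v\<^sup>2 = 1 - psi"
    then show ?thesis using UV psi_bounds by auto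
  next
    assume "u\<^sup>2 = 1 - psi" "v\<^sup>2 = 2"
    then show ?thesis using UV psi_bounds by auto
  next
    assume *: "u\<^sup>2 = psi + 2" "v\<^sup>2 = psi + 2"
    have "u\<^sup>2 * v\<^sup>2 = 5 + 3 * psi" unfolding * by (simp add: algebra_simps psi_mult)
    then show ?thesis using UV psi_bounds by auto
  next
    assume *: "u\<^sup>2 = 1 - psi" "v\<^sup>2 = 1 - psi"
    have "u\<^sup>2 * v\<^sup>2 = 2 - 3 * psi" unfolding * by (simp add: algebra_simps psi_mult)
    then show ?thesis using UV psi_bounds by auto
  qed (use ne4 in simp_all)
  have abs: "\<bar>u\<bar> = sqrt (u\<^sup>2)" "\<bar>v\<bar> = sqrt (v\<^sup>2)" by simp_all
  have roots: "sqrt (psi + 2) = psi + 1" "sqrt (1 - psi) = psi"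
    using psi_square psi_pos by (auto intro!: real_sqrt_unique simp: power2_eq_square algebra_simps)
  have nth: "base_pairs ! 0 = (1, 1)" "base_pairs ! 1 = (1, sqrt 2)" "base_pairs ! 2 = (1, psi + 1)"
    "base_pairs ! 3 = (1, psi)" "base_pairs ! 4 = (psi + 1, psi)"
    by (simp_all add: base_pairs_def)
  have five: "0 < (5::nat)" "1 < (5::nat)" "2 < (5::nat)" "3 < (5::nat)" "4 < (5::nat)" by simp_all
  have "\<exists>P\<in>{base_pairs ! 0, base_pairs ! 1, base_pairs ! 2, base_pairs ! 3, base_pairs ! 4}.
      (\<bar>u\<bar>, \<bar>v\<bar>) = P \<or> (\<bar>v\<bar>, \<bar>u\<bar>) = P"
    using pairs unfolding nth abs by (elim insertE emptyE) (simp_all add: roots)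
  then show ?thesis using five by blast
qed

text \<open>The orbit of \<open>t\<close> meets some \<open>(0, u, v)\<close> whose absolute values
  form a base pair. The zero makes signs and order irrelevant, and the moves are invertible, which
  leads back to \<open>t\<close>.\<close>

lemma good_in_base_orbit:
  assumes good: "good t" and ne4: "markov t \<noteq> 4"
  shows "\<exists>i<5. cls t \<in> braid_orbit (base_triples ! i)"
proof -
  note co = good_cos_orbit[OF good] and adm = good_at_most_one_zero[OF good]
  obtain u v where uv: "(0, u, v) \<in> orb t" using orbit_contains_zero[OF co ne4 adm] by blast
  have special: "special x" if "(x, y, z) \<in> orb t" for x y z
    using first_coordinate_special(1)[OF cos_orbit_orb[OF co that]] markov_orb[OF that] ne4
      at_most_one_zero_orb[OF that adm] by metis
  have "u \<in> two_cos" "v \<in> two_cos" using cos_orbitD[OF co uv] by blast+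
  then obtain a b :: real where ab: "u = of_real a" "v = of_real b" by (metis two_cos_real)
  have "special u" "special v" using orb_coords[OF uv] special by blast+
  \<comment> \<open>\<open>orb_2\<close> sends \<open>(0, u, v)\<close> to
    \<open>(v, u, u * v)\<close>.\<close>
  moreover have "special (u * v)" using orb_coords(2)[OF orb_2[OF uv]] special by auto
  moreover have "a \<noteq> 0" "b \<noteq> 0" 
    using at_most_one_zero_orb[OF uv adm] by (auto simp: at_most_one_zero_def ab)
  moreover have "a\<^sup>2 + b\<^sup>2 \<noteq> 4"
  proof
    assume "a\<^sup>2 + b\<^sup>2 = 4"
    then have "complex_of_real (a\<^sup>2 + b\<^sup>2) = 4" by simp
    then show False using markov_orb[OF uv] ne4 by (simp add: ab)
  qed
  ultimately obtain i where i: "i < 5" "(\<bar>a\<bar>, \<bar>b\<bar>) = base_pairs ! i \<or> (\<bar>b\<bar>, \<bar>a\<bar>) = base_pairs ! i"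
    using special_pairs[of a b] by (auto simp: ab)
  have "cls (0, of_real \<bar>a\<bar>, of_real \<bar>b\<bar>) \<in> braid_orbit (base_triples ! i)"
  proof -
    have "fst (base_pairs ! i) = \<bar>a\<bar> \<and> snd (base_pairs ! i) = \<bar>b\<bar> \<or>
        fst (base_pairs ! i) = \<bar>b\<bar> \<and> snd (base_pairs ! i) = \<bar>a\<bar>"
      using i(2) by (metis fst_conv snd_conv)
    then show ?thesis
      using braid_orbit_base_permutations[OF i(1)] by (auto simp: all_permutations_in_def)
  qed
  moreover have "cls (0, of_real \<bar>a\<bar>, of_real \<bar>b\<bar>) = cls (0, u, v)"
    by (auto simp: cls_eq_iff ab abs_if)
  ultimately have "cls (0, u, v) \<in> braid_orbit (base_triples ! i)" by simp
  from braid_orbit_orb[OF orb_sym[OF uv] this] i(1) show ?thesis by blast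
qed

section \<open>Finiteness and distinctness of the five orbits\<close>

lemma braid_orbit_real: "braid_orbit (map3 of_real t) = (\<lambda>s. cls (map3 of_real s)) ` orb t"
proof -
  have "orb (map3 complex_of_real t) = map3 of_real ` orb t" by (rule orb_hom) simp_all
  then show ?thesis by (simp add: braid_orbit_eq image_image)
qed

definition base_values :: "nat \<Rightarrow> real set" where
  "base_values i = (if i < 2 then {0, 1, - 1, sqrt 2, - sqrt 2} else golden_values)"

definition real_base :: "nat \<Rightarrow> real \<times> real \<times> real" where
  "real_base i = (0, - fst (base_pairs ! i), - snd (base_pairs ! i))"

lemma markov_real_base:
  "markov (real_base 0) = 2" "markov (real_base 1) = 3" "markov (real_base 2) = psi + 3"
  "markov (real_base 3) = 2 - psi" "markov (real_base 4) = 3"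
  using psi_square by (simp_all add: real_base_def base_pairs_def power2_eq_square algebra_simps)

lemma orb_real_base:
  assumes "i < 5"
  shows "orb (real_base i) \<subseteq> base_values i \<times> base_values i \<times> base_values i"
proof (rule orb_subset_cube)
  note cases = less_5_cases[OF assms]
  show "real_base i \<in> base_values i \<times> base_values i \<times> base_values i"
    using cases by (elim disjE) (simp_all add: real_base_def base_values_def base_pairs_def golden_values_def)
  fix x y z
  assume xyz: "x \<in> base_values i" "y \<in> base_values i" "z \<in> base_values i" 
    and m: "markov (x, y, z) = markov (real_base i)"
  show "x * y - z \<in> base_values i"
  proof (cases "i < 2")
    case True
    then have "i = 0 \<or> i = 1" by auto
    then have "markov (x, y, z) \<in> {2, 3}" unfolding m by (elim disjE) (simp_all only: markov_real_base insert_iff simp_thms)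
    with True xyz show ?thesis unfolding base_values_def by (simp only: if_True sqrt2_values_vieta)
  next
    case False
    then have "markov (x, y, z) \<in> {3, psi + 3, 2 - psi}"
      unfolding m using cases by (elim disjE) (simp_all only: markov_real_base insert_iff simp_thms)
    with False xyz show ?thesis unfolding base_values_def by (simp only: if_False golden_values_vieta)
  qed
qed

lemma finite_base_orbit:
  assumes "i < 5" shows "finite (braid_orbit (base_triples ! i))"
proof -
  have "finite (base_values i)" by (simp add: base_values_def golden_values_def)
  then have "finite (orb (real_base i))"
    by (intro finite_subset[OF orb_real_base[OF assms]]) simp
  then show ?thesis unfolding trig_triple_base[OF assms] real_base_def[symmetric] braid_orbit_real
    by (rule finite_imageI)
qed

text \<open>The level \<open>markov\<close> separates all base orbits except those with indices 1
  and 4, both at level 3. The former has a triple with coordinate \<open>- sqrt 2\<close>, while all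
  coordinates in the latter are golden values up to sign.\<close>

lemma base_orbits_distinct:
  assumes i: "i < 5" and j: "j < 5" and eq: "braid_orbit (base_triples ! i) = braid_orbit (base_triples ! j)"
  shows "i = j"
proof -
  have base: "base_triples ! k = map3 of_real (real_base k)" if "k < 5" for k
    using trig_triple_base[OF that] by (simp only: real_base_def)
  have *: "\<exists>s\<in>orb (real_base l). sign_eq (base_triples ! k) (map3 of_real s)"
    if "k < 5" "l < 5" "braid_orbit (base_triples ! k) = braid_orbit (base_triples ! l)" for k l
  proof -
    have "cls (base_triples ! k) \<in> braid_orbit (map3 of_real (real_base l))"
      using braid_orbit_base[of "base_triples ! k"] that base by metis
    then obtain s where "s \<in> orb (real_base l)" "cls (base_triples ! k) = cls (map3 of_real s)"
      unfolding braid_orbit_real by blast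
    then show ?thesis unfolding cls_eq_iff by blast
  qed
  have markov_eq: "markov (real_base k) = markov (real_base l)"
    if kl: "k < 5" "l < 5" "braid_orbit (base_triples ! k) = braid_orbit (base_triples ! l)" for k l
  proof -
    obtain s where s: "s \<in> orb (real_base l)" "sign_eq (base_triples ! k) (map3 of_real s)"
      using *[OF kl] by blast
    have "markov (map3 complex_of_real r) = of_real (markov r)" for r
      by (cases r) simp
    moreover have "markov q = markov r" if "sign_eq q r" for q r :: triple
      using that by (cases q; cases r) (auto simp: power2_eq_square)
    ultimately have "complex_of_real (markov (real_base k)) = of_real (markov s)"
      using s(2) base[OF kl(1)] by metis
    then show ?thesis using markov_orb[OF s(1)] by (simp only: of_real_eq_iff)
  qed
  have not_1_4: "braid_orbit (base_triples ! 1) \<noteq> braid_orbit (base_triples ! 4)"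
  proof
    assume "braid_orbit (base_triples ! 1) = braid_orbit (base_triples ! 4)"
    then obtain s where s: "s \<in> orb (real_base 4)" "sign_eq (base_triples ! 1) (map3 of_real s)"
      using *[of 1 4] by auto
    obtain a b c where abc: "s = (a, b, c)" by (cases s)
    have "c \<in> golden_values"
      using orb_real_base[of 4] s(1) by (auto simp: abc base_values_def)
    moreover have "c\<^sup>2 = 2"
    proof -
      have "complex_of_real c = of_real (sqrt 2) \<or> complex_of_real c = of_real (- sqrt 2)"
        using s(2) base[of 1] by (auto simp: abc real_base_def base_pairs_def)
      then have "c = sqrt 2 \<or> c = - sqrt 2" unfolding of_real_eq_iff .
      then show ?thesis by auto
    qed
    moreover have "a\<^sup>2 \<noteq> 2" if "a \<in> golden_values" for a
      using that psi_bounds psi_square unfolding golden_values_def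
      by (elim insertE emptyE; hypsubst) (simp_all add: power2_eq_square algebra_simps)
    ultimately show False by blast
  qed
  show ?thesis
    using markov_eq[OF i j eq] not_1_4 eq less_5_cases[OF i] less_5_cases[OF j] psi_bounds
    by (elim disjE) (simp_all add: markov_real_base del: One_nat_def)
qed

text \<open>Each further triple arises from a base triple by Vieta moves, reorderings and changes of
  two signs, all of which keep every permutation inside the orbit.\<close>

lemma further_triples_permutations:
  assumes i: "i < 5" and t: "t \<in> further_triples ! i"
  shows "all_permutations_in (braid_orbit (base_triples ! i)) t"
proof -
  define P where "P = complex_of_real psi"
  have PP: "P * P = 1 - P" using psi_mult(1) unfolding P_def by (metis of_real_1 of_real_diff of_real_mult)
  \<comment> \<open>The Vieta move replaces the zero of \<open>(a, b, 0)\<close> by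
    \<open>a * b\<close>.\<close>
  have base: "all_permutations_in (braid_orbit (base_triples ! i)) (a, b, a * b)"
    if "base_pairs ! i = (a', b')" "a = of_real a'" "b = of_real b'" for a b a' b'
    using all_permutations_in_vieta[OF all_permutations_in_permute(3)[OF braid_orbit_base_permutations[OF i]]]
    by (simp add: that)
  note perm = all_permutations_in_permute and vieta = all_permutations_in_vieta
    and sign = all_permutations_in_sign
  have trig: "trig_triple (2/3) (1/4) (1/4) = (1, - of_real (sqrt 2), - of_real (sqrt 2))"
    "trig_triple (2/3) (1/5) (1/5) = (1, - (P + 1), - (P + 1))"
    "trig_triple (4/5) (4/5) (4/5) = (P + 1, P + 1, P + 1)"
    "trig_triple (2/3) (2/5) (2/5) = (1, - P, - P)"
    "trig_triple (2/5) (2/5) (2/5) = (- P, - P, - P)"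
    "trig_triple (3/5) (1/3) (1/5) = (P, - 1, - (P + 1))"
    "trig_triple (2/5) (1/3) (1/3) = (- P, - 1, - 1)"
    "trig_triple (2/3) (1/3) (1/5) = (1, - 1, - (P + 1))"
    by (simp_all only: trig_triple_def trig_coordinates P_def of_real_1 of_real_minus of_real_add)
  consider "i = 0" | "i = 1" | "i = 2" | "i = 3" | "i = 4" using i by linarith
  then show ?thesis
  proof cases
    case 1
    have "all_permutations_in (braid_orbit (base_triples ! i)) (1, 1, 1 * 1)"
      by (rule base[of 1 1]) (simp_all add: 1 base_pairs_def)
    then show ?thesis using t by (simp add: 1 further_triples_def cos_60)
  next
    case 2
    define Q where "Q = complex_of_real (sqrt 2)"
    have "all_permutations_in (braid_orbit (base_triples ! i)) (1, Q, 1 * Q)"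
      by (rule base[of 1 "sqrt 2"]) (simp_all add: 2 base_pairs_def Q_def)
    then have "all_permutations_in (braid_orbit (base_triples ! i)) (1, - Q, - Q)"
      using sign(1) by simp
    moreover have "t = (1, - Q, - Q)" using t trig(1) by (simp add: 2 further_triples_def Q_def)
    ultimately show ?thesis by simp
  next
    case 3
    define Q where "Q = P + 1"
    have *: "all_permutations_in (braid_orbit (base_triples ! i)) (1, Q, 1 * Q)"
      by (rule base[of 1 "psi + 1"]) (simp_all add: 3 base_pairs_def P_def Q_def)
    then have a: "all_permutations_in (braid_orbit (base_triples ! i)) (1, - Q, - Q)"
      using sign(1) by simp
    \<comment> \<open>\<open>Q\<close> is the golden ratio, so the Vieta move turns
      \<open>(Q, Q, 1)\<close> into \<open>(Q, Q, Q)\<close>.\<close>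
    have "Q * Q - 1 = Q" using PP by (simp add: Q_def algebra_simps)
    then have b: "all_permutations_in (braid_orbit (base_triples ! i)) (Q, Q, Q)"
      using vieta[OF perm(3)[OF *]] by simp
    have "t = (1, - Q, - Q) \<or> t = (Q, Q, Q)"
      using t trig(2,3) by (auto simp: 3 further_triples_def Q_def)
    then show ?thesis using a b by blast
  next
    case 4
    have *: "all_permutations_in (braid_orbit (base_triples ! i)) (1, P, 1 * P)"
      by (rule base[of 1 psi]) (simp_all add: 4 base_pairs_def P_def)
    then have a: "all_permutations_in (braid_orbit (base_triples ! i)) (1, - P, - P)"
      using sign(1) by simp
    have "P * P - 1 = - P" using PP by simp
    then have "all_permutations_in (braid_orbit (base_triples ! i)) (P, P, - P)"
      using vieta[OF perm(3)[OF *]] by simp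
    then have b: "all_permutations_in (braid_orbit (base_triples ! i)) (- P, - P, - P)"
      by (rule sign(3))
    have "t = (1, - P, - P) \<or> t = (- P, - P, - P)"
      using t trig(4,5) by (auto simp: 4 further_triples_def)
    then show ?thesis using a b by blast
  next
    case 5
    have "(P + 1) * P = 1" using PP by (simp add: algebra_simps)
    then have *: "all_permutations_in (braid_orbit (base_triples ! i)) (P + 1, P, 1)"
      using base[of "psi + 1" psi "P + 1" P] by (simp add: 5 base_pairs_def P_def)
    have a: "all_permutations_in (braid_orbit (base_triples ! i)) (P, - 1, - (P + 1))"
      using sign(1)[OF perm(3)[OF *]] by simp
    have "all_permutations_in (braid_orbit (base_triples ! i)) (P + 1, 1, 1)"
      using vieta[OF perm(1)[OF *]] by simp
    from sign(1)[OF perm(3)[OF this]]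
    have b: "all_permutations_in (braid_orbit (base_triples ! i)) (1, - 1, - (P + 1))" by simp
    have "all_permutations_in (braid_orbit (base_triples ! i)) (P, 1, - 1)"
      using vieta[OF perm(3)[OF *]] by simp
    from sign(3)[OF this]
    have c: "all_permutations_in (braid_orbit (base_triples ! i)) (- P, - 1, - 1)" .
    have "t = (P, - 1, - (P + 1)) \<or> t = (- P, - 1, - 1) \<or> t = (1, - 1, - (P + 1))"
      using t trig(6-8) by (auto simp: 5 further_triples_def)
    then show ?thesis using a b c by blast
  qed
qed

theorem theorem1p6:
  shows
    "(\<forall>x1 x2 x3. good (x1, x2, x3) \<and> x1\<^sup>2 + x2\<^sup>2 + x3\<^sup>2 - x1 * x2 * x3 \<noteq> 4 \<longrightarrow>
        (\<exists>i<5. cls (x1, x2, x3) \<in> braid_orbit (base_triples ! i))) \<and>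
     (\<forall>i<5. finite (braid_orbit (base_triples ! i))) \<and>
     (\<forall>i<5. \<forall>j<5. i \<noteq> j \<longrightarrow> braid_orbit (base_triples ! i) \<noteq> braid_orbit (base_triples ! j)) \<and>
     (\<forall>i<5. \<forall>t\<in>insert (base_triples ! i) (further_triples ! i). \<forall>s\<in>permuted t.
        cls s \<in> braid_orbit (base_triples ! i))"
proof (intro conjI allI impI ballI)
  fix x1 x2 x3
  assume "good (x1, x2, x3) \<and> x1\<^sup>2 + x2\<^sup>2 + x3\<^sup>2 - x1 * x2 * x3 \<noteq> 4"
  then show "\<exists>i<5. cls (x1, x2, x3) \<in> braid_orbit (base_triples ! i)"
    by (intro good_in_base_orbit) auto
next
  fix i :: nat and t s
  assume i: "i < 5" and t: "t \<in> insert (base_triples ! i) (further_triples ! i)" and s: "s \<in> permuted t"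
  have "all_permutations_in (braid_orbit (base_triples ! i)) (base_triples ! i)"
    using all_permutations_in_sign(1)[OF braid_orbit_base_permutations[OF i]]
    by (simp add: trig_triple_base[OF i])
  with t further_triples_permutations[OF i] s show "cls s \<in> braid_orbit (base_triples ! i)"
    unfolding all_permutations_in_def by blast
qed (use finite_base_orbit base_orbits_distinct in blast)+

end
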